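(* Let $\sigma < -2$ and $p > -1-\sigma$, and set \[ a = \frac{\sigma+2}{1-p} \in (0,1), \qquad c_a = \big(a(1-a)\big)^{1/(p-1)}, \qquad u_a(x) = c_a x^a . \] Consider positive solutions $u \in C^2(0,+\infty)$ of $u''(x) + x^\sigma u(x)^p = 0$ for $x>0$. Then: (1) if $a > 1/2$, there is such a solution $u$ with $\lim_{x\searrow0} u(x)/u_a(x) = 0$ and $\lim_{x\nearrow+\infty} u(x)/u_a(x) = 1$; (2) if $a = 1/2$, there is such a solution $u$ with $\lim_{x\searrow0} u(x)/u_a(x) = 0$ and $\lim_{x\nearrow+\infty} u(x)/u_a(x) = 0$; (3) if $a < 1/2$, there is such a solution $u$ with $\lim_{x\searrow0} u(x)/u_a(x) = 1$ and $\lim_{x\nearrow+\infty} u(x)/u_a(x) = 0$. Moreover, in each case the solution with the stated asymptotic behaviour is unique up to the scaling transformation $u \mapsto u_\lambda$, $u_\lambda(x) = \lambda^{-a} u(\lambda x)$, $\lambda>0$.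
   Context: The function $u_a$ is itself a positive solution of the same equation on $(0,+\infty)$. *)

theory Defs
  imports "HOL-Analysis.Analysis"
begin

definition exp_a :: "real \<Rightarrow> real \<Rightarrow> real" where
  "exp_a \<sigma> p = (\<sigma> + 2) / (1 - p)"

definition const_a :: "real \<Rightarrow> real \<Rightarrow> real" where
  "const_a \<sigma> p = (exp_a \<sigma> p * (1 - exp_a \<sigma> p)) powr (1 / (p - 1))"

definition u_a :: "real \<Rightarrow> real \<Rightarrow> real \<Rightarrow> real" where
  "u_a \<sigma> p x = const_a \<sigma> p * x powr (exp_a \<sigma> p)"

definition pos_sol :: "real \<Rightarrow> real \<Rightarrow> (real \<Rightarrow> real) \<Rightarrow> bool" where
  "pos_sol \<sigma> p u \<longleftrightarrow>
     (\<exists>u' u''. continuous_on {0<..} u'' \<and>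
        (\<forall>x>0. u x > 0 \<and> (u has_real_derivative u' x) (at x) \<and>
               (u' has_real_derivative u'' x) (at x) \<and>
               u'' x + x powr \<sigma> * (u x) powr p = 0))"

definition asym_sol :: "real \<Rightarrow> real \<Rightarrow> real \<Rightarrow> real \<Rightarrow> (real \<Rightarrow> real) \<Rightarrow> bool" where
  "asym_sol \<sigma> p L0 Linf u \<longleftrightarrow> pos_sol \<sigma> p u \<and>
     ((\<lambda>x. u x / u_a \<sigma> p x) \<longlongrightarrow> L0) (at_right 0) \<and>
     ((\<lambda>x. u x / u_a \<sigma> p x) \<longlongrightarrow> Linf) at_top"

definition exists_unique_scaling :: "real \<Rightarrow> real \<Rightarrow> real \<Rightarrow> real \<Rightarrow> bool" where
  "exists_unique_scaling \<sigma> p L0 Linf \<longleftrightarrow>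
     (\<exists>u. asym_sol \<sigma> p L0 Linf u \<and>
        (\<forall>v. asym_sol \<sigma> p L0 Linf v \<longrightarrow>
           (\<exists>l>0. \<forall>x>0. v x = l powr (- exp_a \<sigma> p) * u (l * x))))"

end

theory Submission
  imports Defs
begin

text \<open>
  With x = exp t and u(x) = x powr a * w(t) the equation becomes autonomous,
  w'' + (2a - 1) w' - a(1 - a) w + w powr p = 0, the scaling of u becomes translation in t,
  and t -> -t exchanges a and 1 - a; so let a be at least 1/2.

  Uniqueness. If w tends to 0 at minus infinity, then exp((2a - 1) t) w' is eventually increasing,
  which forces w' > 0 there, and this in turn gives w' > (1 - a - delta) w for every delta > 0. Hence
  the decay is fast enough for z = u(x)/x and V = u'(x) to have a common finite positive limit at
  x = 0, normalised to 1 by a translation. In the variable r = x powr ((p - 1)(1 - a)) the function z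
  then solves a regular Volterra equation with a Lipschitz nonlinearity, so it is determined.

  Existence for a > 1/2. The Volterra equation, with the nonlinearity clamped to [0, 1], is solved
  globally by a contraction argument. The energy w'^2/2 - a(1 - a) w^2/2 + w^(p+1)/(p+1) decreases
  from 0, hence is negative, so w cannot vanish and stays bounded; since the energy converges,
  Barbalat's lemma gives w' -> 0 and w'' -> 0, so w tends to the positive equilibrium.
  For a = 1/2 there is an explicit homoclinic solution.
\<close>

section \<open>Volterra equations\<close>

text \<open>Integrating exp (2 L s) costs a factor 1 / (2 L), so the prefactor L leaves exactly 1/2.
  This makes a Volterra operator with Lipschitz constant L a contraction in the weighted sup norm,
  whatever the length of the interval.\<close>

lemma integral_exp_weight_le:
  fixes h :: "real \<Rightarrow> real"
  assumes "L > 0" "r \<ge> 0" "M \<ge> 0" and cont: "continuous_on {0..r} h"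
    and le: "\<And>s. 0 \<le> s \<Longrightarrow> s \<le> r \<Longrightarrow> \<bar>h s\<bar> \<le> M * exp (2 * L * s)"
  shows "L * integral {0..r} (\<lambda>s. \<bar>h s\<bar>) \<le> M / 2 * exp (2 * L * r)"
proof -
  have I: "((\<lambda>s. M * exp (2 * L * s)) has_integral
      M / (2 * L) * exp (2 * L * r) - M / (2 * L) * exp (2 * L * 0)) {0..r}"
    using assms(1,2)
    by (intro fundamental_theorem_of_calculus)
       (auto intro!: derivative_eq_intros simp flip: has_real_derivative_iff_has_vector_derivative)
  have J: "(\<lambda>s. \<bar>h s\<bar>) integrable_on {0..r}"
    by (intro integrable_continuous_real continuous_intros cont)
  have "integral {0..r} (\<lambda>s. \<bar>h s\<bar>) \<le> M / (2 * L) * exp (2 * L * r) - M / (2 * L) * exp (2 * L * 0)"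
    using has_integral_le[OF integrable_integral[OF J] I] le by auto
  also have "\<dots> \<le> M / (2 * L) * exp (2 * L * r)"
    using assms by simp
  finally have "L * integral {0..r} (\<lambda>s. \<bar>h s\<bar>) \<le> L * (M / (2 * L) * exp (2 * L * r))"
    using \<open>L > 0\<close> by (intro mult_left_mono) auto
  then show ?thesis using \<open>L > 0\<close> by simp
qed

text \<open>Gronwall's inequality without inhomogeneous term, by the same weight: at the point
  \<open>r0\<close> where exp (- 2 L s) |d s| is largest on [0, r], the hypothesis bounds that
  maximum by half of itself.\<close>

lemma gronwall_zero:
  fixes d :: "real \<Rightarrow> real"
  assumes "L > 0" and cont: "continuous_on {0..} d"
    and le: "\<And>r. r \<ge> 0 \<Longrightarrow> \<bar>d r\<bar> \<le> L * integral {0..r} (\<lambda>s. \<bar>d s\<bar>)"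
    and "r \<ge> 0"
  shows "d r = 0"
proof -
  define f where "f s = exp (- (2 * L * s)) * \<bar>d s\<bar>" for s
  have "continuous_on {0..r} f"
    unfolding f_def by (intro continuous_intros continuous_on_subset[OF cont]) auto
  then obtain r0 where r0: "0 \<le> r0" "r0 \<le> r" and max: "\<And>s. 0 \<le> s \<Longrightarrow> s \<le> r \<Longrightarrow> f s \<le> f r0"
    using continuous_attains_sup[of "{0..r}" f] \<open>r \<ge> 0\<close> by auto
  have "\<bar>d s\<bar> \<le> f r0 * exp (2 * L * s)" if "0 \<le> s" "s \<le> r0" for s
    using max[of s] that r0 by (simp add: f_def exp_minus field_simps)
  then have "L * integral {0..r0} (\<lambda>s. \<bar>d s\<bar>) \<le> f r0 / 2 * exp (2 * L * r0)"
    using r0 \<open>L > 0\<close>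
    by (intro integral_exp_weight_le continuous_on_subset[OF cont]) (auto simp: f_def)
  then have "\<bar>d r0\<bar> \<le> \<bar>d r0\<bar> / 2"
    using le[of r0] r0 by (simp add: f_def exp_minus field_simps)
  then have "f r0 = 0" by (simp add: f_def)
  then have "f r \<le> 0" using max[of r] \<open>r \<ge> 0\<close> by simp
  then show ?thesis by (simp add: f_def mult_le_0_iff)
qed

text \<open>Banach's theorem for functions that are bounded and continuous after division by exp (2
  L s). The growth hypothesis puts the image of 0 in this space, and the Lipschitz bound then puts
  all images there. The whole half-line is covered at once, without continuation of local
  solutions.\<close>

lemma volterra_fixed_point:
  fixes T :: "(real \<Rightarrow> real) \<Rightarrow> real \<Rightarrow> real"
  assumes "L > 0" "B \<ge> 0"
    and cont: "\<And>z. continuous_on {0..} z \<Longrightarrow> continuous_on {0..} (T z)"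
    and lip: "\<And>y z r. continuous_on {0..} y \<Longrightarrow> continuous_on {0..} z \<Longrightarrow> r \<ge> 0 \<Longrightarrow>
      \<bar>T y r - T z r\<bar> \<le> L * integral {0..r} (\<lambda>s. \<bar>y s - z s\<bar>)"
    and growth: "\<And>r. r \<ge> 0 \<Longrightarrow> \<bar>T (\<lambda>_. 0) r\<bar> \<le> B * exp (2 * L * r)"
  obtains z where "continuous_on {0..} z" "\<And>r. r \<ge> 0 \<Longrightarrow> T z r = z r"
proof -
  \<comment> \<open>\<open>W\<close> restores the weight, and \<open>S0\<close> is \<open>T\<close>
    conjugated by the weight. The \<open>max 0 r\<close> extends it constantly to negative r,
    because the bounded continuous functions used here live on the whole line.\<close>
  define W where "W f s = exp (2 * L * s) * apply_bcontfun f s" for f :: "real \<Rightarrow>\<^sub>C real" and s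
  define S0 where "S0 f r = exp (- (2 * L * max 0 r)) * T (W f) (max 0 r)" for f r
  have contW: "continuous_on A (W f)" for f A
    unfolding W_def by (intro continuous_intros) auto
  have Wdiff: "L * integral {0..r} (\<lambda>s. \<bar>W f s - W g s\<bar>) \<le> dist f g / 2 * exp (2 * L * r)"
    if "r \<ge> 0" for f g r
  proof (rule integral_exp_weight_le)
    show "continuous_on {0..r} (\<lambda>s. W f s - W g s)"
      by (intro continuous_intros contW)
    fix s
    have "\<bar>W f s - W g s\<bar> = \<bar>exp (2 * L * s) * (apply_bcontfun f s - apply_bcontfun g s)\<bar>"
      by (simp add: W_def algebra_simps)
    also have "\<dots> = exp (2 * L * s) * dist (apply_bcontfun f s) (apply_bcontfun g s)"
      by (simp add: abs_mult dist_real_def)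
    also have "\<dots> \<le> exp (2 * L * s) * dist f g"
      by (intro mult_left_mono dist_bounded) auto
    finally show "\<bar>W f s - W g s\<bar> \<le> dist f g * exp (2 * L * s)" by (simp add: mult.commute)
  qed (use that \<open>L > 0\<close> in auto)
  have W0: "W 0 = (\<lambda>_. 0)"
    by (simp add: W_def fun_eq_iff)
  have S0diff: "\<bar>S0 f r - S0 g r\<bar> \<le> dist f g / 2" for f g r
  proof -
    define s where "s = max 0 r"
    have "s \<ge> 0" by (simp add: s_def)
    have "\<bar>S0 f r - S0 g r\<bar> = \<bar>exp (- (2 * L * s)) * (T (W f) s - T (W g) s)\<bar>"
      by (simp add: S0_def s_def algebra_simps)
    also have "\<dots> = exp (- (2 * L * s)) * \<bar>T (W f) s - T (W g) s\<bar>"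
      by (simp add: abs_mult)
    also have "\<dots> \<le> exp (- (2 * L * s)) * (dist f g / 2 * exp (2 * L * s))"
      using order_trans[OF lip[OF contW contW \<open>s \<ge> 0\<close>] Wdiff[OF \<open>s \<ge> 0\<close>]]
      by (intro mult_left_mono) auto
    also have "\<dots> = dist f g / 2" by (simp add: exp_minus)
    finally show ?thesis .
  qed
  have S0_bcont: "S0 f \<in> bcontfun" for f
  proof (rule bcontfun_normI)
    have "continuous_on UNIV (\<lambda>r. T (W f) (max 0 r))"
      by (rule continuous_on_compose2[OF cont[OF contW]]) (auto intro!: continuous_intros)
    then show "continuous_on UNIV (S0 f)"
      unfolding S0_def by (intro continuous_intros)
    fix r
    have "\<bar>S0 0 r\<bar> \<le> B"
    proof -
      define s where "s = max 0 r"
      have "s \<ge> 0" by (simp add: s_def)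
      have "\<bar>S0 0 r\<bar> = exp (- (2 * L * s)) * \<bar>T (\<lambda>_. 0) s\<bar>"
        by (simp add: S0_def s_def W0 abs_mult)
      also have "\<dots> \<le> exp (- (2 * L * s)) * (B * exp (2 * L * s))"
        using growth[OF \<open>s \<ge> 0\<close>] by (intro mult_left_mono) auto
      finally show ?thesis by (simp add: exp_minus field_simps)
    qed
    then show "norm (S0 f r) \<le> B + dist f 0 / 2"
      using S0diff[of f r 0] unfolding real_norm_def by linarith
  qed
  have "\<exists>!f. Bcontfun (S0 f) = f"
  proof (rule banach_fix_type)
    show "\<forall>f g. dist (Bcontfun (S0 f)) (Bcontfun (S0 g)) \<le> 1/2 * dist f g"
      by (intro allI dist_bound)
         (use S0diff in \<open>simp add: Bcontfun_inverse[OF S0_bcont] dist_real_def\<close>)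
  qed auto
  then obtain f where "Bcontfun (S0 f) = f" by blast
  then have f: "apply_bcontfun f = S0 f"
    using Bcontfun_inverse[OF S0_bcont] by metis
  show ?thesis
  proof
    show "continuous_on {0..} (W f)" by (rule contW)
    fix r :: real assume "r \<ge> 0"
    then show "T (W f) r = W f r"
      unfolding W_def[of f r] f by (simp add: S0_def exp_minus)
  qed
qed

section \<open>The Emden Volterra equation\<close>

text \<open>Clamping makes the nonlinearity bounded and globally Lipschitz, as the global
  contraction argument requires. For 0 <= s <= 1, the range of the normalised positive solutions, it
  is the true power.\<close>

definition clamped_powr :: "real \<Rightarrow> real \<Rightarrow> real" where
  "clamped_powr p s = max 0 (min 1 s) powr p"

lemma powr_diff_le:
  fixes p :: real
  assumes "p > 1" "0 \<le> x" "x \<le> y" "y \<le> 1"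
  shows "y powr p - x powr p \<le> p * (y - x)"
proof (cases "x < y")
  case True
  have "\<exists>l t. x < t \<and> t < y \<and> ((\<lambda>s. s powr p) has_real_derivative l) (at t) \<and>
      y powr p - x powr p = (y - x) * l"
  proof (rule MVT[OF True])
    show "continuous_on {x..y} (\<lambda>s. s powr p)"
      using assms by (intro continuous_on_powr' continuous_intros) auto
    show "(\<lambda>s. s powr p) differentiable (at t)" if "x < t" "t < y" for t
      using has_real_derivative_powr[of t p] assms that by (auto simp: real_differentiable_def)
  qed
  then obtain l t where t: "x < t" "t < y" "((\<lambda>s. s powr p) has_real_derivative l) (at t)"
      "y powr p - x powr p = (y - x) * l" by blast
  have "l = p * t powr (p - 1)"
    using DERIV_unique[OF t(3) has_real_derivative_powr] t assms by auto
  moreover have "t powr (p - 1) \<le> 1"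
    using powr_mono2[of "p - 1" t 1] t assms by auto
  ultimately have "l \<le> p" using assms by (simp add: mult_left_le)
  then show ?thesis using t(4) assms by (metis diff_ge_0_iff_ge mult.commute mult_left_mono)
qed (use assms in auto)

lemma clamped_powr_lipschitz:
  assumes "p > 1"
  shows "\<bar>clamped_powr p x - clamped_powr p y\<bar> \<le> p * \<bar>x - y\<bar>"
proof -
  have *: "\<bar>clamped_powr p x - clamped_powr p y\<bar> \<le> p * \<bar>x - y\<bar>" if "x \<le> y" for x y
  proof -
    define x' y' where "x' = max 0 (min 1 x)" and "y' = max 0 (min 1 y)"
    have b: "0 \<le> x'" "x' \<le> y'" "y' \<le> 1" "y' - x' \<le> y - x"
      using that by (auto simp: x'_def y'_def)
    have "x' powr p \<le> y' powr p" using b assms by (intro powr_mono2) auto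
    moreover have "y' powr p - x' powr p \<le> p * (y' - x')"
      by (rule powr_diff_le) (use b assms in auto)
    moreover have "p * (y' - x') \<le> p * (y - x)" using b assms by simp
    ultimately show ?thesis using that by (simp add: clamped_powr_def x'_def y'_def)
  qed
  show ?thesis
    using *[of x y] *[of y x] by (cases "x \<le> y") (auto simp: abs_minus_commute)
qed

lemma clamped_powr_bounds: "0 \<le> clamped_powr p s" "p > 0 \<Longrightarrow> clamped_powr p s \<le> 1"
  using powr_mono2[of p "max 0 (min 1 s)" 1] by (auto simp: clamped_powr_def)

lemma clamped_powr_eq: "s \<le> 1 \<Longrightarrow> clamped_powr p s = max 0 s powr p"
  by (simp add: clamped_powr_def)

lemma continuous_on_clamped_powr [continuous_intros]:
  assumes "p > 1" "continuous_on A f"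
  shows "continuous_on A (\<lambda>x. clamped_powr p (f x))"
  unfolding clamped_powr_def using assms
  by (intro continuous_on_powr' continuous_intros) auto

text \<open>Apart from the clamp, and with s = y^\<mu>, r = x^\<mu>, q = 1/\<mu>, z = u(x)/x, this
  is u(x) = x - (integral from 0 to x of (x - y) y^\<sigma> u(y)^p dy), the equation with u(0) = 0
  and u'(0) = 1. The choice \<mu> = p + 1 + \<sigma> = (p - 1) (1 - a) leaves no weight in ds. At r
  = 0 the integral is empty and the value is 1.\<close>

definition emden_volterra :: "real \<Rightarrow> real \<Rightarrow> (real \<Rightarrow> real) \<Rightarrow> real \<Rightarrow> real" where
  "emden_volterra p q z r =
     1 - q * integral {0..r} (\<lambda>s. (1 - (s / r) powr q) * clamped_powr p (z s))"

lemma DERIV_integral_0: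
  fixes h :: "real \<Rightarrow> real"
  assumes "continuous_on {0..} h" "r > 0"
  shows "((\<lambda>x. integral {0..x} h) has_real_derivative h r) (at r)"
proof -
  have "continuous_on {0..r + 1} h" using assms by (auto intro: continuous_on_subset)
  from integral_has_real_derivative[OF this, of r]
  have "((\<lambda>x. integral {0..x} h) has_real_derivative h r) (at r within {0..r + 1})"
    using \<open>r > 0\<close> by simp
  moreover have "at r within {0..r + 1} = at r"
    using \<open>r > 0\<close> by (intro at_within_interior) simp
  ultimately show ?thesis by simp
qed

context
  fixes p q :: real
  assumes p: "p > 1" and q: "q > 0"
begin

lemma continuous_on_kernel:
  assumes "continuous_on {0..} z" "r \<ge> 0"
  shows "continuous_on {0..r} (\<lambda>s. (1 - (s / r) powr q) * clamped_powr p (z s))"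
proof (cases "r = 0")
  case False
  then show ?thesis
    using assms p q
    by (intro continuous_intros continuous_on_powr' continuous_on_subset[OF assms(1)]) auto
qed auto

lemma kernel_bounds:
  assumes "0 \<le> s" "s \<le> r"
  shows "0 \<le> 1 - (s / r) powr q" "1 - (s / r) powr q \<le> 1"
proof -
  have "s / r \<le> 1" using assms by (auto simp: divide_le_eq)
  then have "(s / r) powr q \<le> 1" using powr_mono2[of q "s / r" 1] assms q by auto
  then show "0 \<le> 1 - (s / r) powr q" by simp
qed simp

text \<open>Frees the integrands of r, so that the fundamental theorem of calculus applies to the
  two moments.\<close>

lemma emden_volterra_split:
  assumes z: "continuous_on {0..} z" and "r > 0"
  shows "emden_volterra p q z r = 1 - q * (integral {0..r} (\<lambda>s. clamped_powr p (z s)) -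
    r powr (- q) * integral {0..r} (\<lambda>s. s powr q * clamped_powr p (z s)))"
proof -
  have i: "(\<lambda>s. clamped_powr p (z s)) integrable_on {0..r}"
      "(\<lambda>s. s powr q * clamped_powr p (z s)) integrable_on {0..r}"
    using p q
    by (auto intro!: integrable_continuous_real continuous_intros continuous_on_powr'
        continuous_on_subset[OF z])
  have "integral {0..r} (\<lambda>s. (1 - (s / r) powr q) * clamped_powr p (z s)) =
      integral {0..r} (\<lambda>s. clamped_powr p (z s) - r powr (- q) * (s powr q * clamped_powr p (z s)))"
    using \<open>r > 0\<close>
    by (intro integral_cong) (auto simp: powr_divide powr_minus field_simps)
  also have "\<dots> = integral {0..r} (\<lambda>s. clamped_powr p (z s)) -
      r powr (- q) * integral {0..r} (\<lambda>s. s powr q * clamped_powr p (z s))"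
    using i by (subst integral_diff) (auto intro: integrable_on_mult_right)
  finally show ?thesis by (simp add: emden_volterra_def)
qed

text \<open>Kernel and clamped power both lie in [0, 1]. The lower bound serves for continuity at 0;
  the upper one shows that the clamp at 1 does not alter a fixed point.\<close>

lemma emden_volterra_bounds:
  assumes z: "continuous_on {0..} z" and "r \<ge> 0"
  shows "1 - q * r \<le> emden_volterra p q z r" "emden_volterra p q z r \<le> 1"
proof -
  let ?k = "\<lambda>s. (1 - (s / r) powr q) * clamped_powr p (z s)"
  have i: "?k integrable_on {0..r}"
    by (intro integrable_continuous_real continuous_on_kernel assms)
  have "0 \<le> integral {0..r} ?k"
    by (intro integral_nonneg i) (auto intro!: mult_nonneg_nonneg kernel_bounds clamped_powr_bounds)
  then show "emden_volterra p q z r \<le> 1" using q by (simp add: emden_volterra_def)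
  have "?k s \<le> 1" if "s \<in> {0..r}" for s
    using mult_mono[of "1 - (s / r) powr q" 1 "clamped_powr p (z s)" 1]
      kernel_bounds[of s r] clamped_powr_bounds[of p "z s"] p that by simp
  then have "integral {0..r} ?k \<le> integral {0..r} (\<lambda>_. 1)"
    by (intro integral_le i) auto
  then have "integral {0..r} ?k \<le> r" using \<open>r \<ge> 0\<close> by simp
  then show "1 - q * r \<le> emden_volterra p q z r" using q by (simp add: emden_volterra_def)
qed

lemma continuous_on_emden_volterra:
  assumes z: "continuous_on {0..} z"
  shows "continuous_on {0..} (emden_volterra p q z)"
  unfolding continuous_on_eq_continuous_within
proof
  fix r :: real assume "r \<in> {0..}"
  show "continuous (at r within {0..}) (emden_volterra p q z)"
  proof (cases "r = 0")
    case True
    \<comment> \<open>The split form breaks down at 0 because of \<open>r powr (- q)\<close>; the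
      linear bounds squeeze the value to 1 instead.\<close>
    have "((\<lambda>r. 1 - q * r) \<longlongrightarrow> 1 - q * 0) (at 0 within {0..})"
      by (intro tendsto_intros)
    then have lim: "((\<lambda>r. 1 - q * r) \<longlongrightarrow> 1) (at 0 within {0..})" by simp
    have "(emden_volterra p q z \<longlongrightarrow> 1) (at 0 within {0..})"
    proof (rule tendsto_sandwich[OF _ _ lim tendsto_const])
      show "\<forall>\<^sub>F r in at 0 within {0..}. 1 - q * r \<le> emden_volterra p q z r"
        by (rule eventually_at_filter[THEN iffD2], rule always_eventually)
           (metis emden_volterra_bounds(1)[OF z] atLeast_iff)
      show "\<forall>\<^sub>F r in at 0 within {0..}. emden_volterra p q z r \<le> 1"
        by (rule eventually_at_filter[THEN iffD2], rule always_eventually)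
           (metis emden_volterra_bounds(2)[OF z] atLeast_iff)
    qed
    moreover have "emden_volterra p q z 0 = 1" by (simp add: emden_volterra_def)
    ultimately show ?thesis using True by (simp add: continuous_within)
  next
    case False
    then have "r > 0" using \<open>r \<in> {0..}\<close> by simp
    have c: "continuous_on {0..} (\<lambda>s. clamped_powr p (z s))"
        "continuous_on {0..} (\<lambda>s. s powr q * clamped_powr p (z s))"
      using p q by (auto intro!: continuous_intros continuous_on_powr' z)
    have "isCont (\<lambda>r. 1 - q * (integral {0..r} (\<lambda>s. clamped_powr p (z s)) -
        r powr (- q) * integral {0..r} (\<lambda>s. s powr q * clamped_powr p (z s)))) r"
      using c[THEN DERIV_integral_0, OF \<open>r > 0\<close>, THEN DERIV_isCont] \<open>r > 0\<close>
      by (intro continuous_intros) auto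
    moreover have "eventually (\<lambda>x. x > 0) (nhds r)"
      using \<open>r > 0\<close> by (auto intro: eventually_nhds_in_open[of "{0<..}", simplified])
    then have "eventually (\<lambda>x. emden_volterra p q z x =
        1 - q * (integral {0..x} (\<lambda>s. clamped_powr p (z s)) -
        x powr (- q) * integral {0..x} (\<lambda>s. s powr q * clamped_powr p (z s)))) (nhds r)"
      by eventually_elim (rule emden_volterra_split[OF z])
    ultimately have "isCont (emden_volterra p q z) r"
      by (subst isCont_cong)
    then show ?thesis by (rule continuous_at_imp_continuous_within)
  qed
qed

lemma emden_volterra_lipschitz:
  assumes y: "continuous_on {0..} y" and z: "continuous_on {0..} z" and r: "r \<ge> 0"
  shows "\<bar>emden_volterra p q y r - emden_volterra p q z r\<bar>
    \<le> p * q * integral {0..r} (\<lambda>s. \<bar>y s - z s\<bar>)"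
proof -
  let ?k = "\<lambda>z s. (1 - (s / r) powr q) * clamped_powr p (z s)"
  have i: "?k y integrable_on {0..r}" "?k z integrable_on {0..r}"
    by (intro integrable_continuous_real continuous_on_kernel y z r)+
  have j: "(\<lambda>s. p * \<bar>y s - z s\<bar>) integrable_on {0..r}"
    by (intro integrable_continuous_real continuous_intros continuous_on_subset[OF y]
        continuous_on_subset[OF z]) auto
  have "\<bar>emden_volterra p q y r - emden_volterra p q z r\<bar> =
      \<bar>q * integral {0..r} (\<lambda>s. ?k y s - ?k z s)\<bar>"
    unfolding emden_volterra_def integral_diff[OF i] by (simp add: algebra_simps abs_minus_commute)
  also have "\<dots> = q * norm (integral {0..r} (\<lambda>s. ?k y s - ?k z s))"
    using q by (simp add: abs_mult)
  also have "norm (integral {0..r} (\<lambda>s. ?k y s - ?k z s)) \<le> integral {0..r} (\<lambda>s. p * \<bar>y s - z s\<bar>)"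
  proof (rule integral_norm_bound_integral[OF integrable_diff[OF i] j])
    fix s assume s: "s \<in> {0..r}"
    have "norm (?k y s - ?k z s) = (1 - (s / r) powr q) * \<bar>clamped_powr p (y s) - clamped_powr p (z s)\<bar>"
      using kernel_bounds[of s r] s by (simp add: abs_mult flip: right_diff_distrib)
    also have "\<dots> \<le> 1 * (p * \<bar>y s - z s\<bar>)"
      by (intro mult_mono clamped_powr_lipschitz p) (use kernel_bounds[of s r] s in auto)
    finally show "norm (?k y s - ?k z s) \<le> p * \<bar>y s - z s\<bar>" by simp
  qed
  finally show ?thesis using q by (simp add: mult_ac)
qed

lemma emden_volterra_solution:
  obtains z where "continuous_on {0..} z" "\<And>r. r \<ge> 0 \<Longrightarrow> emden_volterra p q z r = z r"
proof (rule volterra_fixed_point[where T = "emden_volterra p q" and L = "p * q" and B = 1])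
  fix r :: real assume "r \<ge> 0"
  then show "\<bar>emden_volterra p q (\<lambda>_. 0) r\<bar> \<le> 1 * exp (2 * (p * q) * r)"
    using p q by (simp add: emden_volterra_def clamped_powr_def)
qed (use p q emden_volterra_lipschitz continuous_on_emden_volterra in auto)

lemma emden_volterra_unique:
  assumes y: "continuous_on {0..} y" "\<And>r. r \<ge> 0 \<Longrightarrow> emden_volterra p q y r = y r"
    and z: "continuous_on {0..} z" "\<And>r. r \<ge> 0 \<Longrightarrow> emden_volterra p q z r = z r"
    and "r \<ge> 0"
  shows "y r = z r"
proof -
  have "y r - z r = 0"
  proof (rule gronwall_zero[where L = "p * q" and d = "\<lambda>r. y r - z r"])
    show "continuous_on {0..} (\<lambda>r. y r - z r)" by (intro continuous_intros y z)
    show "\<bar>y r - z r\<bar> \<le> p * q * integral {0..r} (\<lambda>s. \<bar>y s - z s\<bar>)" if "r \<ge> 0" for r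
      using emden_volterra_lipschitz[OF y(1) z(1) that] y(2) z(2) that by simp
  qed (use p q \<open>r \<ge> 0\<close> in auto)
  then show ?thesis by simp
qed

end

section \<open>The Volterra equation as a first-order system in t = ln x\<close>

lemma const_eq_limit_at_bot:
  fixes f :: "real \<Rightarrow> real"
  assumes "\<And>t. (f has_real_derivative 0) (at t)" "(f \<longlongrightarrow> c) at_bot"
  shows "f t = c"
proof -
  have "f = (\<lambda>_. f t)" using DERIV_isconst_all[of f] assms(1) by (auto simp: fun_eq_iff)
  then have "((\<lambda>_::real. f t) \<longlongrightarrow> c) at_bot" using assms(2) by simp
  then show ?thesis by (simp add: tendsto_const_iff)
qed

lemma tendsto_exp_mult_at_bot: "c > 0 \<Longrightarrow> ((\<lambda>t::real. exp (c * t)) \<longlongrightarrow> 0) at_bot"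
  by (intro filterlim_compose[OF exp_at_bot] filterlim_tendsto_pos_mult_at_bot[OF tendsto_const])
     (auto simp: filterlim_ident)

lemma filterlim_exp_mult_at_right_0:
  "c > 0 \<Longrightarrow> filterlim (\<lambda>t::real. exp (c * t)) (at_right 0) at_bot"
  by (rule filterlim_at_withinI[OF tendsto_exp_mult_at_bot]) auto

context
  fixes p \<mu> :: real
  assumes p: "p > 1" and \<mu>: "\<mu> > 0"
begin

lemma exp_powr_inverse: "exp (\<mu> * t) powr (1 / \<mu>) = exp t"
  using \<mu> by (simp add: powr_def)

lemma emden_moments_deriv:
  assumes z: "continuous_on {0..} z"
  shows "((\<lambda>t. integral {0..exp (\<mu> * t)} (\<lambda>s. clamped_powr p (z s))) has_real_derivative
           \<mu> * exp (\<mu> * t) * clamped_powr p (z (exp (\<mu> * t)))) (at t)"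
    and "((\<lambda>t. integral {0..exp (\<mu> * t)} (\<lambda>s. s powr (1 / \<mu>) * clamped_powr p (z s)))
           has_real_derivative
           \<mu> * exp (\<mu> * t) * (exp t * clamped_powr p (z (exp (\<mu> * t))))) (at t)"
proof -
  have c: "continuous_on {0..} (\<lambda>s. clamped_powr p (z s))"
      "continuous_on {0..} (\<lambda>s. s powr (1 / \<mu>) * clamped_powr p (z s))"
    using p \<mu> by (auto intro!: continuous_intros continuous_on_powr' z)
  have e: "((\<lambda>t. exp (\<mu> * t)) has_real_derivative \<mu> * exp (\<mu> * t)) (at t)"
    by (auto intro!: derivative_eq_intros)
  show "((\<lambda>t. integral {0..exp (\<mu> * t)} (\<lambda>s. clamped_powr p (z s))) has_real_derivative
           \<mu> * exp (\<mu> * t) * clamped_powr p (z (exp (\<mu> * t)))) (at t)"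
    using DERIV_chain2[OF DERIV_integral_0[OF c(1)] e] by (simp add: mult_ac)
  show "((\<lambda>t. integral {0..exp (\<mu> * t)} (\<lambda>s. s powr (1 / \<mu>) * clamped_powr p (z s)))
           has_real_derivative
           \<mu> * exp (\<mu> * t) * (exp t * clamped_powr p (z (exp (\<mu> * t))))) (at t)"
    using DERIV_chain2[OF DERIV_integral_0[OF c(2)] e] by (simp add: mult_ac exp_powr_inverse)
qed

lemma emden_moments_at_bot:
  assumes z: "continuous_on {0..} z"
  shows "((\<lambda>t. integral {0..exp (\<mu> * t)} (\<lambda>s. clamped_powr p (z s))) \<longlongrightarrow> 0) at_bot"
    and "((\<lambda>t. integral {0..exp (\<mu> * t)} (\<lambda>s. s powr (1 / \<mu>) * clamped_powr p (z s))) \<longlongrightarrow> 0) at_bot"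
proof -
  have *: "((\<lambda>t. integral {0..exp (\<mu> * t)} h) \<longlongrightarrow> 0) at_bot"
    if h: "continuous_on {0..} h" for h :: "real \<Rightarrow> real"
  proof -
    have "h integrable_on {0..1}"
      by (intro integrable_continuous_real continuous_on_subset[OF h]) auto
    then have "continuous_on {0..1} (\<lambda>x. integral {0..x} h)"
      by (rule indefinite_integral_continuous_1)
    then have "((\<lambda>x. integral {0..x} h) \<longlongrightarrow> integral {0..0} h) (at 0 within {0..1})"
      unfolding continuous_on_def by (rule bspec) simp
    then have "((\<lambda>x. integral {0..x} h) \<longlongrightarrow> 0) (at_right 0)"
      by (simp add: at_within_Icc_at_right)
    then show ?thesis by (rule filterlim_compose[OF _ filterlim_exp_mult_at_right_0[OF \<mu>]])
  qed
  show "((\<lambda>t. integral {0..exp (\<mu> * t)} (\<lambda>s. clamped_powr p (z s))) \<longlongrightarrow> 0) at_bot"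
    "((\<lambda>t. integral {0..exp (\<mu> * t)} (\<lambda>s. s powr (1 / \<mu>) * clamped_powr p (z s))) \<longlongrightarrow> 0) at_bot"
    using p \<mu> by (auto intro!: * continuous_intros continuous_on_powr' z)
qed

lemma emden_system_exists:
  obtains z V where
    "\<And>t. (z has_real_derivative V t - z t) (at t)"
    "\<And>t. (V has_real_derivative - exp (\<mu> * t) * clamped_powr p (z t)) (at t)"
    "\<And>t. z t \<le> 1" "(z \<longlongrightarrow> 1) at_bot" "(V \<longlongrightarrow> 1) at_bot"
proof -
  obtain Z where Z: "continuous_on {0..} Z"
      and Z_fix: "\<And>r. r \<ge> 0 \<Longrightarrow> emden_volterra p (1 / \<mu>) Z r = Z r"
    using emden_volterra_solution[of p "1 / \<mu>"] p \<mu> by auto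
  define G where "G t = integral {0..exp (\<mu> * t)} (\<lambda>s. clamped_powr p (Z s))" for t
  define H where "H t = integral {0..exp (\<mu> * t)} (\<lambda>s. s powr (1 / \<mu>) * clamped_powr p (Z s))" for t
  define z where "z t = Z (exp (\<mu> * t))" for t
  \<comment> \<open>\<open>V\<close> plays the role of u'(x), with \<open>G\<close> accumulating the
    contribution of - u''; the split kernel gives z - V = exp (- t) H / \<mu>.\<close>
  define V where "V t = 1 - 1 / \<mu> * G t" for t
  have G: "(G has_real_derivative \<mu> * exp (\<mu> * t) * clamped_powr p (z t)) (at t)"
    and H: "(H has_real_derivative \<mu> * exp (\<mu> * t) * (exp t * clamped_powr p (z t))) (at t)" for t
    unfolding G_def H_def z_def using emden_moments_deriv[OF Z] by auto
  have V': "(V has_real_derivative - exp (\<mu> * t) * clamped_powr p (z t)) (at t)" for t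
    unfolding V_def using \<mu> by (auto intro!: derivative_eq_intros G)
  have z: "z t = V t + 1 / \<mu> * exp (- t) * H t" for t
    unfolding z_def using Z_fix[of "exp (\<mu> * t)"] emden_volterra_split[OF p _ Z, of "1 / \<mu>" "exp (\<mu> * t)"] \<mu>
    by (simp add: V_def G_def H_def powr_minus exp_powr_inverse exp_minus algebra_simps)
  show ?thesis
  proof
    fix t
    have "((\<lambda>t. V t + 1 / \<mu> * exp (- t) * H t) has_real_derivative
        - exp (\<mu> * t) * clamped_powr p (z t) + (1 / \<mu> * (- exp (- t)) * H t
          + \<mu> * exp (\<mu> * t) * (exp t * clamped_powr p (z t)) * (1 / \<mu> * exp (- t)))) (at t)"
      using \<mu> by (auto intro!: derivative_eq_intros V' H simp: field_simps)
    also have "- exp (\<mu> * t) * clamped_powr p (z t) + (1 / \<mu> * (- exp (- t)) * H t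
          + \<mu> * exp (\<mu> * t) * (exp t * clamped_powr p (z t)) * (1 / \<mu> * exp (- t))) = V t - z t"
      using \<mu> by (simp add: z[of t] exp_minus)
    finally show "(z has_real_derivative V t - z t) (at t)" by (simp add: z[abs_def])
    show "z t \<le> 1"
      using emden_volterra_bounds(2)[OF p _ Z, of "1 / \<mu>" "exp (\<mu> * t)"] Z_fix[of "exp (\<mu> * t)"] \<mu>
      by (simp add: z_def)
    show "(V has_real_derivative - exp (\<mu> * t) * clamped_powr p (z t)) (at t)" by (rule V')
  next
    have "(Z \<longlongrightarrow> Z 0) (at 0 within {0..})"
      using Z by (simp add: continuous_on_def)
    moreover have "Z 0 = 1" using Z_fix[of 0] by (simp add: emden_volterra_def)
    ultimately have "(Z \<longlongrightarrow> 1) (at 0 within {0..})" by simp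
    then have "(Z \<longlongrightarrow> 1) (at_right 0)"
      by (rule tendsto_within_subset) auto
    then show "(z \<longlongrightarrow> 1) at_bot"
      unfolding z_def by (rule filterlim_compose[OF _ filterlim_exp_mult_at_right_0[OF \<mu>]])
    have "((\<lambda>t. 1 - 1 / \<mu> * G t) \<longlongrightarrow> 1 - 1 / \<mu> * 0) at_bot"
      unfolding G_def by (intro tendsto_intros emden_moments_at_bot Z)
    then show "(V \<longlongrightarrow> 1) at_bot" by (simp add: V_def[abs_def])
  qed
qed

text \<open>The converse passage, which carries uniqueness over from the Volterra equation to the
  system. The quantities V + G / \<mu> and exp t (z - V) - H / \<mu> have derivative zero, and the
  limits at minus infinity fix their values as 1 and 0. At r = 0 the function \<open>Z\<close> takes
  its limit value.\<close>

lemma emden_system_volterra: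
  assumes z': "\<And>t. (z has_real_derivative V t - z t) (at t)"
    and V': "\<And>t. (V has_real_derivative - exp (\<mu> * t) * clamped_powr p (z t)) (at t)"
    and lim: "(z \<longlongrightarrow> 1) at_bot" "(V \<longlongrightarrow> 1) at_bot"
  defines "Z \<equiv> \<lambda>r. if r = 0 then 1 else z (ln r / \<mu>)"
  shows "continuous_on {0..} Z" "r \<ge> 0 \<Longrightarrow> emden_volterra p (1 / \<mu>) Z r = Z r"
proof -
  show Z: "continuous_on {0..} Z"
    unfolding continuous_on_eq_continuous_within
  proof
    fix r :: real assume "r \<in> {0..}"
    show "continuous (at r within {0..}) Z"
    proof (cases "r = 0")
      case True
      have "filterlim (\<lambda>r. ln r / \<mu>) at_bot (at_right 0)"
        using filterlim_tendsto_pos_mult_at_bot[OF tendsto_const _ ln_at_0, of "1 / \<mu>"] \<mu> by simp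
      then have "((\<lambda>r. z (ln r / \<mu>)) \<longlongrightarrow> 1) (at_right 0)"
        by (rule filterlim_compose[OF lim(1)])
      then have "(Z \<longlongrightarrow> 1) (at_right 0)"
        by (rule Lim_transform_eventually) (auto simp: Z_def eventually_at_filter)
      then have "(Z \<longlongrightarrow> 1) (at 0 within {0..})"
        unfolding Lim_within by fastforce
      then show ?thesis by (simp add: continuous_within True Z_def)
    next
      case False
      then have r: "r > 0" using \<open>r \<in> {0..}\<close> by simp
      have "isCont (\<lambda>r. z (ln r / \<mu>)) r"
        using r \<mu> by (intro isCont_o2[OF _ DERIV_isCont[OF z']] continuous_intros) auto
      moreover have "eventually (\<lambda>x. x > 0) (nhds r)"
        using r by (auto intro: eventually_nhds_in_open[of "{0<..}", simplified])
      then have "eventually (\<lambda>x. Z x = z (ln x / \<mu>)) (nhds r)"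
        by eventually_elim (auto simp: Z_def)
      ultimately have "isCont Z r" by (subst isCont_cong)
      then show ?thesis by (rule continuous_at_imp_continuous_within)
    qed
  qed
  have Zexp: "Z (exp (\<mu> * t)) = z t" for t using \<mu> by (simp add: Z_def)
  define G where "G t = integral {0..exp (\<mu> * t)} (\<lambda>s. clamped_powr p (Z s))" for t
  define H where "H t = integral {0..exp (\<mu> * t)} (\<lambda>s. s powr (1 / \<mu>) * clamped_powr p (Z s))" for t
  have G: "(G has_real_derivative \<mu> * exp (\<mu> * t) * clamped_powr p (z t)) (at t)"
    and H: "(H has_real_derivative \<mu> * exp (\<mu> * t) * (exp t * clamped_powr p (z t))) (at t)" for t
    unfolding G_def H_def using emden_moments_deriv[OF Z, of t] by (auto simp: Zexp)
  have V: "V t + 1 / \<mu> * G t = 1" for t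
  proof (rule const_eq_limit_at_bot[of "\<lambda>t. V t + 1 / \<mu> * G t"])
    show "((\<lambda>t. V t + 1 / \<mu> * G t) has_real_derivative 0) (at t)" for t
      using \<mu> by (auto intro!: derivative_eq_intros V' G)
    have "((\<lambda>t. V t + 1 / \<mu> * G t) \<longlongrightarrow> 1 + 1 / \<mu> * 0) at_bot"
      unfolding G_def by (intro tendsto_intros lim emden_moments_at_bot Z)
    then show "((\<lambda>t. V t + 1 / \<mu> * G t) \<longlongrightarrow> 1) at_bot" by simp
  qed
  have W: "exp t * (z t - V t) - 1 / \<mu> * H t = 0" for t
  proof (rule const_eq_limit_at_bot[of "\<lambda>t. exp t * (z t - V t) - 1 / \<mu> * H t"])
    show "((\<lambda>t. exp t * (z t - V t) - 1 / \<mu> * H t) has_real_derivative 0) (at t)" for t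
      using \<mu> by (auto intro!: derivative_eq_intros z' V' H simp: algebra_simps)
    have "((\<lambda>t. exp t * (z t - V t) - 1 / \<mu> * H t) \<longlongrightarrow> 0 * (1 - 1) - 1 / \<mu> * 0) at_bot"
      unfolding H_def by (intro tendsto_intros lim emden_moments_at_bot exp_at_bot Z)
    then show "((\<lambda>t. exp t * (z t - V t) - 1 / \<mu> * H t) \<longlongrightarrow> 0) at_bot" by simp
  qed
  show "emden_volterra p (1 / \<mu>) Z r = Z r" if "r \<ge> 0" for r
  proof (cases "r = 0")
    case False
    define t where "t = ln r / \<mu>"
    have r: "r = exp (\<mu> * t)" using False that \<mu> by (simp add: t_def)
    \<comment> \<open>Eliminating \<open>V\<close> between the two conserved quantities leaves the
      split form of the Volterra operator.\<close>
    have "exp (- t) * (1 / \<mu> * H t) = exp (- t) * (exp t * (z t - V t))"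
      using W[of t] by simp
    also have "\<dots> = z t - V t" by (simp add: exp_minus)
    finally have "z t = 1 - 1 / \<mu> * (G t - exp (- t) * H t)"
      using V[of t] by algebra
    then show ?thesis
      using emden_volterra_split[OF p _ Z, of "1 / \<mu>" "exp (\<mu> * t)"] \<mu>
      unfolding r Zexp G_def H_def powr_minus exp_powr_inverse exp_minus by simp
  qed (simp add: emden_volterra_def Z_def)
qed

lemma emden_system_unique:
  assumes "\<And>t. (z has_real_derivative V t - z t) (at t)"
    and "\<And>t. (V has_real_derivative - exp (\<mu> * t) * clamped_powr p (z t)) (at t)"
    and "(z \<longlongrightarrow> 1) at_bot" "(V \<longlongrightarrow> 1) at_bot"
    and "\<And>t. (y has_real_derivative U t - y t) (at t)"
    and "\<And>t. (U has_real_derivative - exp (\<mu> * t) * clamped_powr p (y t)) (at t)"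
    and "(y \<longlongrightarrow> 1) at_bot" "(U \<longlongrightarrow> 1) at_bot"
  shows "z t = y t"
proof -
  let ?Z = "\<lambda>r. if r = 0 then 1 else z (ln r / \<mu>)" and ?Y = "\<lambda>r. if r = 0 then 1 else y (ln r / \<mu>)"
  have "?Z r = ?Y r" if "r \<ge> 0" for r
    by (rule emden_volterra_unique[OF p _ emden_system_volterra[OF assms(1-4)]
          emden_system_volterra[OF assms(5-8)] that]) (use \<mu> in auto)
  from this[of "exp (\<mu> * t)"] show ?thesis using \<mu> by simp
qed

end

section \<open>Solutions decaying at minus infinity\<close>

definition emden_sol :: "real \<Rightarrow> real \<Rightarrow> (real \<Rightarrow> real) \<Rightarrow> (real \<Rightarrow> real) \<Rightarrow> bool" where
  "emden_sol a p w w1 \<longleftrightarrow> (\<forall>t. w t > 0 \<and> (w has_real_derivative w1 t) (at t) \<and>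
     (w1 has_real_derivative (1 - 2 * a) * w1 t + a * (1 - a) * w t - w t powr p) (at t))"

lemma emden_solD:
  assumes "emden_sol a p w w1"
  shows "w t > 0" "(w has_real_derivative w1 t) (at t)"
    "(w1 has_real_derivative (1 - 2 * a) * w1 t + a * (1 - a) * w t - w t powr p) (at t)"
  using assms by (auto simp: emden_sol_def)

lemma emden_sol_shift:
  assumes "emden_sol a p w w1"
  shows "emden_sol a p (\<lambda>t. w (t + \<tau>)) (\<lambda>t. w1 (t + \<tau>))"
  using assms by (simp add: emden_sol_def flip: DERIV_shift)

text \<open>In the original variables z = u(x)/x and V = u'(x) at x = exp t. The third formula keeps
  w in place of z, for estimating V' from the decay of w.\<close>

lemma emden_sol_system:
  assumes "emden_sol a p w w1"
  defines "z \<equiv> \<lambda>t. exp ((a - 1) * t) * w t" and "V \<equiv> \<lambda>t. exp ((a - 1) * t) * (w1 t + a * w t)"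
  shows "(z has_real_derivative V t - z t) (at t)"
    and "(V has_real_derivative - exp ((p - 1) * (1 - a) * t) * z t powr p) (at t)"
    and "(V has_real_derivative - exp ((a - 1) * t) * w t powr p) (at t)"
proof -
  note D = emden_solD[OF assms(1)]
  show "(z has_real_derivative V t - z t) (at t)"
    unfolding z_def V_def by (auto intro!: derivative_eq_intros D simp: algebra_simps)
  show V': "(V has_real_derivative - exp ((a - 1) * t) * w t powr p) (at t)"
    unfolding V_def by (auto intro!: derivative_eq_intros D simp: algebra_simps)
  have "exp ((p - 1) * (1 - a) * t) * z t powr p = exp ((a - 1) * t) * w t powr p"
    using D(1)[of t]
    by (simp add: z_def powr_mult powr_def[of "exp _"] flip: exp_add mult.assoc)
       (simp add: algebra_simps)
  then show "(V has_real_derivative - exp ((p - 1) * (1 - a) * t) * z t powr p) (at t)"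
    using V' by simp
qed

text \<open>The inverse substitution. The positive part is kept because a solution of the clamped
  equation is not yet known to be positive at this point.\<close>

lemma emden_system_deriv:
  assumes z: "\<And>t. (z has_real_derivative V t - z t) (at t)"
    and V: "\<And>t. (V has_real_derivative - exp ((p - 1) * (1 - a) * t) * max 0 (z t) powr p) (at t)"
  defines "w \<equiv> \<lambda>t. exp ((1 - a) * t) * z t" and "w1 \<equiv> \<lambda>t. exp ((1 - a) * t) * (V t - a * z t)"
  shows "(w has_real_derivative w1 t) (at t)"
    and "(w1 has_real_derivative (1 - 2 * a) * w1 t + a * (1 - a) * w t - max 0 (w t) powr p) (at t)"
proof -
  show "(w has_real_derivative w1 t) (at t)"
    unfolding w_def w1_def by (auto intro!: derivative_eq_intros z V simp: algebra_simps)
  have "max 0 (w t) = exp ((1 - a) * t) * max 0 (z t)"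
    by (simp add: w_def max_def zero_le_mult_iff)
  then have e: "max 0 (w t) powr p =
      exp ((1 - a) * t) * (exp ((p - 1) * (1 - a) * t) * max 0 (z t) powr p)"
    by (simp add: powr_mult powr_def[of "exp _"] flip: exp_add mult.assoc)
       (simp add: algebra_simps)
  show "(w1 has_real_derivative (1 - 2 * a) * w1 t + a * (1 - a) * w t - max 0 (w t) powr p) (at t)"
    unfolding e unfolding w_def w1_def
    by (auto intro!: derivative_eq_intros z V simp: algebra_simps)
qed

lemma antimono_bounded_tendsto_at_bot:
  fixes f :: "real \<Rightarrow> real"
  assumes anti: "\<And>s t. s \<le> t \<Longrightarrow> f t \<le> f s" and bdd: "bdd_above (range f)"
  shows "(f \<longlongrightarrow> Sup (range f)) at_bot"
proof (rule order_tendstoI)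
  fix y assume "y < Sup (range f)"
  then obtain s where "y < f s" using less_cSup_iff[OF _ bdd] by auto
  then have "y < f t" if "t \<le> s" for t using anti[OF that] by simp
  then show "\<forall>\<^sub>F t in at_bot. y < f t" unfolding eventually_at_bot_linorder by blast
next
  fix y assume "Sup (range f) < y"
  then show "\<forall>\<^sub>F t in at_bot. f t < y"
    using cSup_upper[OF rangeI bdd] by (intro always_eventually) (auto intro: le_less_trans)
qed

section \<open>Decay rate and normalisation at minus infinity\<close>

context
  fixes a p :: real and w w1 :: "real \<Rightarrow> real"
  assumes a: "0 < a" "a < 1" and p: "p > 1" and sol: "emden_sol a p w w1"
    and lim0: "(w \<longlongrightarrow> 0) at_bot"
begin

text \<open>The derivative of exp ((2 a - 1) t) w1 is exp ((2 a - 1) t) (a (1 - a) w - w^p),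
  nonnegative while w^(p-1) < a (1 - a). Hence w1 t0 <= 0 would propagate to all earlier times, w
  would be nonincreasing up to t0, and its limit 0 at minus infinity would force w t0 <= 0.\<close>

lemma emden_deriv_pos_near_bot:
  assumes T: "\<And>t. t \<le> T \<Longrightarrow> w t powr (p - 1) < a * (1 - a)" and "t0 \<le> T"
  shows "w1 t0 > 0"
proof (rule ccontr)
  note D = emden_solD[OF sol]
  assume "\<not> w1 t0 > 0"
  have neg: "w1 t \<le> 0" if "t \<le> t0" for t
  proof -
    have "exp ((2 * a - 1) * t) * w1 t \<le> exp ((2 * a - 1) * t0) * w1 t0"
    proof (rule DERIV_nonneg_imp_nondecreasing[OF that], intro exI conjI)
      fix s assume "s \<le> t0"
      show "((\<lambda>t. exp ((2 * a - 1) * t) * w1 t) has_real_derivative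
          exp ((2 * a - 1) * s) * (a * (1 - a) * w s - w s powr p)) (at s)"
        by (auto intro!: derivative_eq_intros D simp: algebra_simps)
      have "w s powr p = w s * w s powr (p - 1)" using D(1)[of s] by (simp add: powr_mult_base)
      also have "\<dots> \<le> w s * (a * (1 - a))"
        using T[of s] \<open>s \<le> t0\<close> \<open>t0 \<le> T\<close> D(1)[of s] by (intro mult_left_mono) auto
      finally show "0 \<le> exp ((2 * a - 1) * s) * (a * (1 - a) * w s - w s powr p)"
        by (simp add: mult.commute)
    qed
    also have "\<dots> \<le> 0" using \<open>\<not> w1 t0 > 0\<close> by (simp add: mult_le_0_iff)
    finally show ?thesis by (simp add: mult_le_0_iff)
  qed
  have "w t0 \<le> w t" if "t \<le> t0" for t
    by (rule DERIV_nonpos_imp_nonincreasing[OF that]) (use D(2) neg in blast)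
  then have "w t0 \<le> 0"
    by (intro tendsto_lowerbound[OF lim0]) (auto simp: eventually_at_bot_linorder)
  then show False using D(1)[of t0] by simp
qed

text \<open>The linearisation at 0 has exponents 1 - a and - a. The factor exp (a t) removes the
  second: exp (a t) Q has derivative exp (a t) (\<delta> w1 + \<delta> a w - w^p), nonnegative
  because w1 > 0 and w is small. A negative Q would then stay below a negative constant towards
  minus infinity, which is incompatible with w1 > 0 and w -> 0.\<close>

lemma emden_log_deriv_near_bot:
  assumes T: "\<And>t. t \<le> T \<Longrightarrow> w t powr (p - 1) < a * (1 - a)"
      "\<And>t. t \<le> T \<Longrightarrow> w t powr (p - 1) < \<delta> * a" and "t0 \<le> T" and \<delta>: "\<delta> > 0"
  shows "(1 - a - \<delta>) * w t0 \<le> w1 t0"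
proof (rule ccontr)
  note D = emden_solD[OF sol]
  define Q where "Q t = w1 t - (1 - a - \<delta>) * w t" for t
  define c where "c = - (exp (a * t0) * Q t0)"
  assume "\<not> (1 - a - \<delta>) * w t0 \<le> w1 t0"
  then have c: "c > 0" by (simp add: c_def Q_def mult_less_0_iff)
  \<comment> \<open>For t <= 0 the factor exp (a t) is at most 1, so dividing the negative bound by
    it only lowers the bound.\<close>
  have "Q t \<le> - c" if "t \<le> min t0 0" for t
  proof -
    have "exp (a * t) * Q t \<le> exp (a * t0) * Q t0"
    proof (rule DERIV_nonneg_imp_nondecreasing[of t t0], use that in simp, intro exI conjI)
      fix s assume "s \<le> t0"
      show "((\<lambda>t. exp (a * t) * Q t) has_real_derivative
          exp (a * s) * (\<delta> * w1 s + \<delta> * a * w s - w s powr p)) (at s)"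
        unfolding Q_def by (auto intro!: derivative_eq_intros D simp: algebra_simps)
      have "w s powr p = w s * w s powr (p - 1)" using D(1)[of s] by (simp add: powr_mult_base)
      also have "\<dots> \<le> w s * (\<delta> * a)"
        using T(2)[of s] \<open>s \<le> t0\<close> \<open>t0 \<le> T\<close> D(1)[of s] by (intro mult_left_mono) auto
      finally have "w s powr p \<le> \<delta> * a * w s" by (simp add: mult_ac)
      moreover have "0 \<le> \<delta> * w1 s"
        using emden_deriv_pos_near_bot[OF T(1), of T s] \<delta> \<open>s \<le> t0\<close> \<open>t0 \<le> T\<close> by auto
      ultimately show "0 \<le> exp (a * s) * (\<delta> * w1 s + \<delta> * a * w s - w s powr p)" by simp
    qed
    then have *: "exp (a * t) * Q t \<le> - c" by (simp add: c_def)
    then have "Q t < 0" using c by (smt (verit) exp_gt_zero mult_nonneg_nonneg)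
    moreover have "exp (a * t) \<le> 1" using that a by (simp add: mult_nonneg_nonpos)
    ultimately have "1 * Q t \<le> exp (a * t) * Q t" by (intro mult_right_mono_neg) auto
    then show ?thesis using * by simp
  qed
  then have "0 \<le> (1 - a - \<delta>) * w t - c" if "t \<le> min (min t0 0) T" for t
    using that emden_deriv_pos_near_bot[OF T(1), of T t] by (force simp: Q_def)
  then have "\<forall>\<^sub>F t in at_bot. 0 \<le> (1 - a - \<delta>) * w t - c"
    unfolding eventually_at_bot_linorder by blast
  moreover have "((\<lambda>t. (1 - a - \<delta>) * w t - c) \<longlongrightarrow> (1 - a - \<delta>) * 0 - c) at_bot"
    by (intro tendsto_intros lim0)
  ultimately have "0 \<le> (1 - a - \<delta>) * 0 - c" by (intro tendsto_lowerbound) auto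
  then show False using c by simp
qed

text \<open>The bound on w1 / w gives w <= C exp (\<gamma> t), which makes V' integrable at minus
  infinity. As V is nonincreasing, it has a finite limit A; and z, an exponentially weighted average
  of V over earlier times, is squeezed between V and A.\<close>

lemma emden_limit_at_bot:
  obtains A where "A > 0" "\<And>t. exp ((a - 1) * t) * w t \<le> A"
    "((\<lambda>t. exp ((a - 1) * t) * w t) \<longlongrightarrow> A) at_bot"
    "((\<lambda>t. exp ((a - 1) * t) * (w1 t + a * w t)) \<longlongrightarrow> A) at_bot"
proof -
  note D = emden_solD[OF sol] and S = emden_sol_system[OF sol]
  define z where "z t = exp ((a - 1) * t) * w t" for t
  define V where "V t = exp ((a - 1) * t) * (w1 t + a * w t)" for t
  \<comment> \<open>With the exact rate 1 - a, V' would be of order exp ((p - 1) (1 - a) t). The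
    loss \<open>\<delta>\<close> is chosen to cost half of this exponent, leaving
    \<open>\<kappa>\<close> > 0.\<close>
  define \<kappa> where "\<kappa> = (p - 1) * (1 - a) / 2"
  define \<delta> where "\<delta> = \<kappa> / p"
  define \<gamma> where "\<gamma> = 1 - a - \<delta>"
  have pos: "\<kappa> > 0" "\<delta> > 0" using a p by (auto simp: \<kappa>_def \<delta>_def)
  have \<kappa>: "a - 1 + p * \<gamma> = \<kappa>" using p by (simp add: \<gamma>_def \<delta>_def \<kappa>_def field_simps)
  have "((\<lambda>t. w t powr (p - 1)) \<longlongrightarrow> 0 powr (p - 1)) at_bot"
    using p D(1) by (intro tendsto_powr' lim0 tendsto_const) (auto intro: always_eventually less_imp_le)
  then have "\<forall>\<^sub>F t in at_bot. w t powr (p - 1) < min (a * (1 - a)) (\<delta> * a)"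
    using a pos by (intro order_tendstoD) auto
  then obtain T where T: "\<And>t. t \<le> T \<Longrightarrow> w t powr (p - 1) < a * (1 - a)"
      "\<And>t. t \<le> T \<Longrightarrow> w t powr (p - 1) < \<delta> * a"
    unfolding eventually_at_bot_linorder by auto
  define C where "C = exp (- \<gamma> * T) * w T"
  have C: "C > 0" using D(1) by (simp add: C_def)
  have wle: "w t \<le> C * exp (\<gamma> * t)" if "t \<le> T" for t
  proof -
    have "exp (- \<gamma> * t) * w t \<le> C"
      unfolding C_def
    proof (rule DERIV_nonneg_imp_nondecreasing[OF that], intro exI conjI)
      fix s assume "s \<le> T"
      show "((\<lambda>t. exp (- \<gamma> * t) * w t) has_real_derivative exp (- \<gamma> * s) * (w1 s - \<gamma> * w s)) (at s)"
        by (auto intro!: derivative_eq_intros D simp: algebra_simps)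
      show "0 \<le> exp (- \<gamma> * s) * (w1 s - \<gamma> * w s)"
        using emden_log_deriv_near_bot[OF T, of T s] pos \<open>s \<le> T\<close> by (auto simp: \<gamma>_def)
    qed
    then show ?thesis by (simp add: exp_minus field_simps)
  qed
  have V': "(V has_real_derivative - exp ((a - 1) * t) * w t powr p) (at t)" for t
    using S(3)[of t] unfolding V_def[abs_def] .
  have anti: "V t \<le> V s" if "s \<le> t" for s t
    by (rule DERIV_nonpos_imp_nonincreasing[OF that])
       (use V' in force)
  have Vle: "V t \<le> V T + C powr p / \<kappa> * exp (\<kappa> * T)" if "t \<le> T" for t
  proof -
    \<comment> \<open>Adding an antiderivative of the bound on - V' gives a nondecreasing function,
      which bounds V from above towards minus infinity.\<close>
    have "V t + C powr p / \<kappa> * exp (\<kappa> * t) \<le> V T + C powr p / \<kappa> * exp (\<kappa> * T)"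
    proof (rule DERIV_nonneg_imp_nondecreasing[OF that], intro exI conjI)
      fix s assume "s \<le> T"
      show "((\<lambda>t. V t + C powr p / \<kappa> * exp (\<kappa> * t)) has_real_derivative
          - exp ((a - 1) * s) * w s powr p + C powr p * exp (\<kappa> * s)) (at s)"
        using pos by (auto intro!: derivative_eq_intros V')
      have "w s powr p \<le> (C * exp (\<gamma> * s)) powr p"
        using wle[OF \<open>s \<le> T\<close>] D(1)[of s] p by (intro powr_mono2) auto
      also have "\<dots> = C powr p * exp (p * \<gamma> * s)"
        using C by (simp add: powr_mult powr_def[of "exp _"])
      finally have "exp ((a - 1) * s) * w s powr p \<le> exp ((a - 1) * s) * (C powr p * exp (p * \<gamma> * s))"
        by simp
      also have "\<dots> = C powr p * exp (\<kappa> * s)"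
        unfolding \<kappa>[symmetric] by (simp add: distrib_right exp_add)
      finally show "0 \<le> - exp ((a - 1) * s) * w s powr p + C powr p * exp (\<kappa> * s)" by simp
    qed
    moreover have "0 \<le> C powr p / \<kappa> * exp (\<kappa> * t)" using pos by simp
    ultimately show ?thesis by linarith
  qed
  have bdd: "bdd_above (range V)"
  proof (rule bdd_aboveI2)
    show "V t \<le> V T + C powr p / \<kappa> * exp (\<kappa> * T)" for t
      using Vle[of t] Vle[of T] anti[of T t] by (cases "t \<le> T") auto
  qed
  define A where "A = Sup (range V)"
  have limV: "(V \<longlongrightarrow> A) at_bot"
    unfolding A_def by (rule antimono_bounded_tendsto_at_bot[OF anti bdd])
  have VA: "V t \<le> A" for t unfolding A_def by (rule cSup_upper[OF rangeI bdd])
  have "V T > 0"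
    using emden_deriv_pos_near_bot[OF T(1), of T T] D(1)[of T] a by (simp add: V_def add_pos_pos)
  then have A: "A > 0" using VA[of T] by simp
  \<comment> \<open>Since exp t * z t = exp (a t) * w t tends to 0, exp t (z t - B) is the integral
    of exp s (V s - B) from minus infinity. The choices B = A and B = V t give the two sides of the
    squeeze.\<close>
  have ez: "((\<lambda>t. exp t * (z t - B)) \<longlongrightarrow> 0) at_bot" for B
  proof -
    have "((\<lambda>t. exp (a * t) * w t - exp t * B) \<longlongrightarrow> 0 * 0 - 0 * B) at_bot"
      by (intro tendsto_intros lim0 exp_at_bot tendsto_exp_mult_at_bot a)
    moreover have "exp (a * t) * w t - exp t * B = exp t * (z t - B)" for t
      by (simp add: z_def right_diff_distrib left_diff_distrib exp_diff)
    ultimately show ?thesis by simp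
  qed
  have z': "(z has_real_derivative V t - z t) (at t)" for t
    using S(1)[of t] unfolding V_def[abs_def] z_def[abs_def] .
  have ez': "((\<lambda>t. exp t * (z t - B)) has_real_derivative exp t * (V t - B)) (at t)" for t B
    by (auto intro!: derivative_eq_intros z' simp: algebra_simps)
  have zA: "z t \<le> A" for t
  proof -
    have "exp t * (z t - A) \<le> exp s * (z s - A)" if "s \<le> t" for s
      by (rule DERIV_nonpos_imp_nonincreasing[OF that])
         (use ez'[of A] VA in \<open>force intro: mult_nonneg_nonpos\<close>)
    then have "exp t * (z t - A) \<le> 0"
      by (intro tendsto_lowerbound[OF ez]) (auto simp: eventually_at_bot_linorder)
    then show ?thesis by (simp add: mult_le_0_iff)
  qed
  have Vz: "V t \<le> z t" for t
  proof -
    have "exp s * (z s - V t) \<le> exp t * (z t - V t)" if "s \<le> t" for s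
      by (rule DERIV_nonneg_imp_nondecreasing[OF that])
         (use ez'[of "V t"] anti in force)
    then have "0 \<le> exp t * (z t - V t)"
      by (intro tendsto_upperbound[OF ez]) (auto simp: eventually_at_bot_linorder)
    then show ?thesis by (simp add: zero_le_mult_iff)
  qed
  have limz: "(z \<longlongrightarrow> A) at_bot"
    by (rule tendsto_sandwich[OF _ _ limV tendsto_const]) (auto intro: always_eventually zA Vz)
  show ?thesis
    by (rule that[OF A]) (use zA limz limV in \<open>simp_all add: z_def[abs_def] V_def[abs_def]\<close>)
qed

text \<open>Translation rescales the limit A, and \<open>\<tau>\<close> with exp ((a - 1) \<tau>) =
  A makes it 1. The bound by A becomes a bound by 1, so the power and its clamped version agree
  along the solution.\<close>

lemma emden_normalised_system:
  obtains \<tau> V where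
    "\<And>t. ((\<lambda>t. exp ((a - 1) * t) * w (t + \<tau>)) has_real_derivative V t - exp ((a - 1) * t) * w (t + \<tau>)) (at t)"
    "\<And>t. (V has_real_derivative
        - exp ((p - 1) * (1 - a) * t) * clamped_powr p (exp ((a - 1) * t) * w (t + \<tau>))) (at t)"
    "((\<lambda>t. exp ((a - 1) * t) * w (t + \<tau>)) \<longlongrightarrow> 1) at_bot" "(V \<longlongrightarrow> 1) at_bot"
proof -
  obtain A where A: "A > 0" "\<And>t. exp ((a - 1) * t) * w t \<le> A"
    "((\<lambda>t. exp ((a - 1) * t) * w t) \<longlongrightarrow> A) at_bot"
    "((\<lambda>t. exp ((a - 1) * t) * (w1 t + a * w t)) \<longlongrightarrow> A) at_bot"
    using emden_limit_at_bot by blast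
  define \<tau> where "\<tau> = - ln A / (1 - a)"
  have e: "exp ((a - 1) * t) = exp ((a - 1) * (t + \<tau>)) / A" for t
  proof -
    have "(a - 1) * \<tau> = ln A" using a by (simp add: \<tau>_def field_simps)
    then show ?thesis using A(1) by (simp add: distrib_left exp_add)
  qed
  note S = emden_sol_system[OF emden_sol_shift[OF sol, of \<tau>]]
  have shift: "filterlim (\<lambda>t. t + \<tau>) at_bot at_bot"
    using filterlim_tendsto_add_at_bot_iff[OF tendsto_const, of \<tau> "\<lambda>t. t" at_bot]
    by (simp add: add.commute filterlim_ident)
  show ?thesis
  proof (rule that)
    fix t
    have "exp ((a - 1) * t) * w (t + \<tau>) \<le> 1" unfolding e[of t] using A(2)[of "t + \<tau>"] A(1) by simp
    moreover have "0 < exp ((a - 1) * t) * w (t + \<tau>)" using emden_solD(1)[OF sol] by simp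
    ultimately have "clamped_powr p (exp ((a - 1) * t) * w (t + \<tau>)) = (exp ((a - 1) * t) * w (t + \<tau>)) powr p"
      by (simp add: clamped_powr_def)
    then show "((\<lambda>t. exp ((a - 1) * t) * (w1 (t + \<tau>) + a * w (t + \<tau>))) has_real_derivative
        - exp ((p - 1) * (1 - a) * t) * clamped_powr p (exp ((a - 1) * t) * w (t + \<tau>))) (at t)"
      using S(2)[of t] by simp
    show "((\<lambda>t. exp ((a - 1) * t) * w (t + \<tau>)) has_real_derivative
        exp ((a - 1) * t) * (w1 (t + \<tau>) + a * w (t + \<tau>)) - exp ((a - 1) * t) * w (t + \<tau>)) (at t)"
      by (rule S(1))
  next
    show "((\<lambda>t. exp ((a - 1) * t) * w (t + \<tau>)) \<longlongrightarrow> 1) at_bot"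
    proof -
      have "(\<lambda>t. exp ((a - 1) * t) * w (t + \<tau>)) =
          (\<lambda>t. exp ((a - 1) * (t + \<tau>)) * w (t + \<tau>) / A)"
        by (rule ext, subst e) simp
      then show ?thesis
        using tendsto_divide[OF filterlim_compose[OF A(3) shift] tendsto_const, of A] A(1) by simp
    qed
    show "((\<lambda>t. exp ((a - 1) * t) * (w1 (t + \<tau>) + a * w (t + \<tau>))) \<longlongrightarrow> 1) at_bot"
    proof -
      have "(\<lambda>t. exp ((a - 1) * t) * (w1 (t + \<tau>) + a * w (t + \<tau>))) =
          (\<lambda>t. exp ((a - 1) * (t + \<tau>)) * (w1 (t + \<tau>) + a * w (t + \<tau>)) / A)"
        by (rule ext, subst e) simp
      then show ?thesis
        using tendsto_divide[OF filterlim_compose[OF A(4) shift] tendsto_const, of A] A(1) by simp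
    qed
  qed
qed

end

text \<open>Each solution, after its own translation, solves the same normalised system, which
  determines z; the two translations then combine into one.\<close>

lemma emden_sol_unique:
  assumes a: "0 < a" "a < 1" and p: "p > 1"
    and w: "emden_sol a p w w1" "(w \<longlongrightarrow> 0) at_bot"
    and v: "emden_sol a p v v1" "(v \<longlongrightarrow> 0) at_bot"
  shows "\<exists>\<tau>. \<forall>t. v t = w (t + \<tau>)"
proof -
  have \<mu>: "(p - 1) * (1 - a) > 0" using a p by simp
  obtain \<tau> V where W: "\<And>t. ((\<lambda>t. exp ((a - 1) * t) * w (t + \<tau>)) has_real_derivative V t - exp ((a - 1) * t) * w (t + \<tau>)) (at t)"
    "\<And>t. (V has_real_derivative
        - exp ((p - 1) * (1 - a) * t) * clamped_powr p (exp ((a - 1) * t) * w (t + \<tau>))) (at t)"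
    "((\<lambda>t. exp ((a - 1) * t) * w (t + \<tau>)) \<longlongrightarrow> 1) at_bot" "(V \<longlongrightarrow> 1) at_bot"
    by (rule emden_normalised_system[OF a p w]) (rule that)
  obtain \<tau>' U where Y: "\<And>t. ((\<lambda>t. exp ((a - 1) * t) * v (t + \<tau>')) has_real_derivative U t - exp ((a - 1) * t) * v (t + \<tau>')) (at t)"
    "\<And>t. (U has_real_derivative
        - exp ((p - 1) * (1 - a) * t) * clamped_powr p (exp ((a - 1) * t) * v (t + \<tau>'))) (at t)"
    "((\<lambda>t. exp ((a - 1) * t) * v (t + \<tau>')) \<longlongrightarrow> 1) at_bot" "(U \<longlongrightarrow> 1) at_bot"
    by (rule emden_normalised_system[OF a p v]) (rule that)
  have "v (t + \<tau>') = w (t + \<tau>)" for t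
    using emden_system_unique[OF p \<mu> W Y, of t] by simp
  from this[of "_ - \<tau>'"] have "v t = w (t + (\<tau> - \<tau>'))" for t by (simp add: algebra_simps)
  then show ?thesis by blast
qed

section \<open>Existence\<close>

text \<open>On a window of length d the mean of g is (G (t + d) - G t) / d, which is eventually
  small and is attained at some point x; between t and x the function g changes by at most d M. The
  choice of d splits \<epsilon> equally between both errors.\<close>

lemma barbalat:
  fixes G g g' :: "real \<Rightarrow> real"
  assumes lim: "(G \<longlongrightarrow> l) at_top"
    and G: "\<And>t. (G has_real_derivative g t) (at t)"
    and g: "\<And>t. (g has_real_derivative g' t) (at t)"
    and M: "\<And>t. \<bar>g' t\<bar> \<le> M" "M > 0"
  shows "(g \<longlongrightarrow> 0) at_top"
proof (rule tendstoI)
  fix \<epsilon> :: real assume \<epsilon>: "\<epsilon> > 0"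
  define d where "d = \<epsilon> / (2 * M)"
  have d: "d > 0" using \<epsilon> M by (simp add: d_def)
  have "\<forall>\<^sub>F t in at_top. dist (G t) l < \<epsilon> * d / 4"
    by (rule tendstoD[OF lim]) (use \<epsilon> d in simp)
  then obtain N where N: "\<And>t. t \<ge> N \<Longrightarrow> dist (G t) l < \<epsilon> * d / 4"
    unfolding eventually_at_top_linorder by blast
  have "dist (g t) 0 < \<epsilon>" if t: "t \<ge> N" for t
  proof -
    obtain x where x: "t < x" "x < t + d" "G (t + d) - G t = (t + d - t) * g x"
      using MVT2[of t "t + d" G g] d G by auto
    have "d * g x = (G (t + d) - l) - (G t - l)" using x(3) by simp
    moreover have "\<bar>G t - l\<bar> < \<epsilon> * d / 4" "\<bar>G (t + d) - l\<bar> < \<epsilon> * d / 4"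
      using N[of t] N[of "t + d"] t d by (auto simp: dist_real_def)
    ultimately have "\<bar>d * g x\<bar> < \<epsilon> * d / 2" by linarith
    then have "\<bar>d * g x\<bar> < d * (\<epsilon> / 2)" by (simp add: mult.commute)
    then have 1: "\<bar>g x\<bar> < \<epsilon> / 2" using d by (simp add: abs_mult)
    obtain y where y: "g x - g t = (x - t) * g' y"
      using MVT2[of t x g g'] x g by auto
    have "\<bar>g x - g t\<bar> = (x - t) * \<bar>g' y\<bar>" using y x by (simp add: abs_mult)
    also have "\<dots> \<le> d * M" using x M by (intro mult_mono) auto
    also have "\<dots> = \<epsilon> / 2" using M by (simp add: d_def)
    finally show ?thesis using 1 unfolding dist_real_def by linarith
  qed
  then show "\<forall>\<^sub>F t in at_top. dist (g t) 0 < \<epsilon>"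
    unfolding eventually_at_top_linorder by blast
qed

text \<open>The energy must be differentiated before w is known to be positive. At 0 the difference
  quotient is \<open>max 0 h powr p\<close>, which tends to 0.\<close>

lemma DERIV_max_powr:
  fixes p :: real
  assumes "p > 0"
  shows "((\<lambda>x. max 0 x powr (p + 1)) has_real_derivative (p + 1) * max 0 x powr p) (at x)"
proof (cases x "0::real" rule: linorder_cases)
  case less
  have "((\<lambda>x. 0) has_real_derivative (p + 1) * max 0 x powr p) (at x)" using less by simp
  then show ?thesis
    by (rule has_field_derivative_transform_within_open[where S = "{..<0}"]) (use less in auto)
next
  case greater
  have "((\<lambda>x. x powr (p + 1)) has_real_derivative (p + 1) * max 0 x powr p) (at x)"
    using has_real_derivative_powr[OF greater, of "p + 1"] greater by simp
  then show ?thesis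
    by (rule has_field_derivative_transform_within_open[where S = "{0<..}"]) (use greater in auto)
next
  case equal
  have "((\<lambda>h::real. max 0 h powr p) \<longlongrightarrow> max 0 0 powr p) (at 0)"
    using assms by (intro tendsto_powr' tendsto_intros) auto
  then have "((\<lambda>h::real. max 0 h powr p) \<longlongrightarrow> 0) (at 0)" by simp
  then have "((\<lambda>h::real. max 0 h powr (p + 1) / h) \<longlongrightarrow> 0) (at 0)"
    by (rule Lim_transform_eventually)
       (auto simp: eventually_at_filter max_def powr_add intro!: always_eventually)
  then show ?thesis by (simp add: equal DERIV_def)
qed

section \<open>Energy and the limit at plus infinity in the damped case\<close>

context
  fixes a p :: real and w w1 :: "real \<Rightarrow> real"
  assumes a: "1/2 < a" "a < 1" and p: "p > 1"
    and w': "\<And>t. (w has_real_derivative w1 t) (at t)"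
    and w1': "\<And>t. (w1 has_real_derivative (1 - 2 * a) * w1 t + a * (1 - a) * w t - max 0 (w t) powr p) (at t)"
    and lim: "(w \<longlongrightarrow> 0) at_bot" "(w1 \<longlongrightarrow> 0) at_bot"
    and pos: "\<forall>\<^sub>F t in at_bot. w t > 0"
begin

text \<open>Kinetic energy plus the potential with derivative max 0 w powr p - a (1 - a) w, so that
  only the damping contributes to its derivative. At a zero of w it reduces to w1^2 / 2.\<close>

definition energy :: "real \<Rightarrow> real" where
  "energy t = (w1 t)\<^sup>2 / 2 - a * (1 - a) * (w t)\<^sup>2 / 2 + max 0 (w t) powr (p + 1) / (p + 1)"

lemma energy_deriv: "(energy has_real_derivative (1 - 2 * a) * (w1 t)\<^sup>2) (at t)"
proof -
  have F: "((\<lambda>t. max 0 (w t) powr (p + 1)) has_real_derivative (p + 1) * max 0 (w t) powr p * w1 t) (at t)"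
    using p by (intro DERIV_chain2[OF DERIV_max_powr w']) auto
  have "((\<lambda>t. (w1 t)\<^sup>2 / 2 - a * (1 - a) * (w t)\<^sup>2 / 2) has_real_derivative
      w1 t * ((1 - 2 * a) * w1 t + a * (1 - a) * w t - max 0 (w t) powr p)
      - a * (1 - a) * w t * w1 t) (at t)"
    by (auto intro!: derivative_eq_intros w' w1')
  from DERIV_add[OF this DERIV_cdivide[OF F, of "p + 1"]]
  have "(energy has_real_derivative
      w1 t * ((1 - 2 * a) * w1 t + a * (1 - a) * w t - max 0 (w t) powr p)
      - a * (1 - a) * w t * w1 t + (p + 1) * max 0 (w t) powr p * w1 t / (p + 1)) (at t)"
    unfolding energy_def[abs_def] .
  moreover have "(p + 1) * max 0 (w t) powr p * w1 t / (p + 1) = max 0 (w t) powr p * w1 t"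
    using p by simp
  ultimately show ?thesis by (simp add: algebra_simps power2_eq_square)
qed

lemma energy_antimono:
  assumes "s \<le> t"
  shows "energy t \<le> energy s"
proof (rule DERIV_nonpos_imp_nonincreasing[OF assms], intro exI conjI)
  show "(energy has_real_derivative (1 - 2 * a) * (w1 x)\<^sup>2) (at x)" for x by (rule energy_deriv)
  show "(1 - 2 * a) * (w1 x)\<^sup>2 \<le> 0" for x using a by (intro mult_nonpos_nonneg) auto
qed

lemma energy_at_bot: "(energy \<longlongrightarrow> 0) at_bot"
proof -
  have "((\<lambda>t. max 0 (w t) powr (p + 1)) \<longlongrightarrow> max 0 0 powr (p + 1)) at_bot"
    using p by (intro tendsto_powr' tendsto_intros lim) auto
  then have "(energy \<longlongrightarrow> 0\<^sup>2 / 2 - a * (1 - a) * 0\<^sup>2 / 2 + max 0 0 powr (p + 1) / (p + 1)) at_bot"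
    unfolding energy_def[abs_def] using p by (intro tendsto_intros lim) auto
  then show ?thesis by simp
qed

text \<open>Monotonicity and the limit 0 give energy <= 0. If it were 0 at t, it would vanish at all
  earlier times; without dissipation w1 = 0 there, so w is constant and equal to its limit 0,
  against positivity near minus infinity.\<close>

lemma energy_neg: "energy t < 0"
proof (rule ccontr)
  assume "\<not> energy t < 0"
  have le: "energy s \<le> 0" for s
    by (rule tendsto_lowerbound[OF energy_at_bot])
       (auto simp: eventually_at_bot_linorder intro!: exI[of _ s] energy_antimono)
  have 0: "energy s = 0" if "s < t" for s
    using le[of s] energy_antimono[of s t] \<open>\<not> energy t < 0\<close> that by auto
  have w1_0: "w1 s = 0" if "s < t" for s
  proof -
    have "((\<lambda>_. 0) has_real_derivative (1 - 2 * a) * (w1 s)\<^sup>2) (at s)"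
      by (rule has_field_derivative_transform_within_open[OF energy_deriv, where S = "{..<t}"])
         (use that 0 in auto)
    then have "(1 - 2 * a) * (w1 s)\<^sup>2 = 0"
      using DERIV_unique[OF _ DERIV_const] by blast
    then show ?thesis using a by simp
  qed
  \<comment> \<open>Ending at t - 1 keeps the closed interval inside s < t, where w1 is known to
    vanish.\<close>
  have const: "w s = w (t - 1)" if "s < t - 1" for s
  proof (rule DERIV_isconst_end[OF that, symmetric])
    show "continuous_on {s..t - 1} w"
      using w' by (auto intro: DERIV_continuous_on has_field_derivative_at_within)
    show "(w has_real_derivative 0) (at x)" if "s < x" "x < t - 1" for x
      using w'[of x] w1_0[of x] that by simp
  qed
  then have "\<forall>\<^sub>F s in at_bot. w s = w (t - 1)"
    unfolding eventually_at_bot_dense by blast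
  then have "((\<lambda>_::real. w (t - 1)) \<longlongrightarrow> 0) at_bot"
    using lim(1) by (simp cong: filterlim_cong)
  then have "w (t - 1) = 0" by (simp add: tendsto_const_iff)
  moreover obtain T where "\<And>s. s \<le> T \<Longrightarrow> w s > 0"
    using pos unfolding eventually_at_bot_linorder by blast
  then have "w (min T (t - 2)) > 0" by simp
  ultimately show False using const[of "min T (t - 2)"] by simp
qed

text \<open>At a zero of w the energy would be nonnegative, and the intermediate value theorem would
  supply such a zero.\<close>

lemma emden_positive: "w t > 0"
proof (rule ccontr)
  assume neg: "\<not> w t > 0"
  obtain T where T: "\<And>s. s \<le> T \<Longrightarrow> w s > 0"
    using pos unfolding eventually_at_bot_linorder by blast
  have "T \<le> t" using T[of t] neg by linarith
  moreover have "\<forall>x. T \<le> x \<and> x \<le> t \<longrightarrow> isCont w x" using w' DERIV_isCont by blast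
  ultimately obtain s where "w s = 0"
    using IVT2[of w t 0 T] T[of T] neg by auto
  then have "energy s \<ge> 0" by (simp add: energy_def)
  then show False using energy_neg[of s] by simp
qed

lemma emden_bounded:
  obtains B where "B > 0" "\<And>t. w t \<le> B" "\<And>t. \<bar>w1 t\<bar> \<le> B"
proof -
  \<comment> \<open>The positive zero of the potential: negative energy confines w below it.\<close>
  define B where "B = (a * (1 - a) * (p + 1) / 2) powr (1 / (p - 1))"
  have k: "0 < a * (1 - a)" "a * (1 - a) \<le> 1"
    using a mult_mono[of a 1 "1 - a" 1] by auto
  have B: "B > 0" using a p by (simp add: B_def)
  have wB: "w t \<le> B" for t
  proof -
    have wt: "w t > 0" by (rule emden_positive)
    have "w t powr (p + 1) / (p + 1) < a * (1 - a) * (w t)\<^sup>2 / 2"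
      using energy_neg[of t] wt zero_le_power2[of "w1 t"] max.absorb2[OF less_imp_le[OF wt]]
      unfolding energy_def by linarith
    moreover have "w t powr (p + 1) = w t powr (p - 1) * (w t)\<^sup>2"
      using wt by (simp add: add.commute flip: powr_numeral powr_add)
    ultimately have "w t powr (p - 1) * (w t)\<^sup>2 < a * (1 - a) * (p + 1) / 2 * (w t)\<^sup>2"
      using p by (simp add: field_simps)
    then have "w t powr (p - 1) < a * (1 - a) * (p + 1) / 2"
      using wt by (simp add: mult_less_cancel_right)
    then have "(w t powr (p - 1)) powr (1 / (p - 1)) \<le> B"
      unfolding B_def using p by (intro powr_mono2) auto
    then show ?thesis using wt p by (simp add: powr_powr)
  qed
  have "\<bar>w1 t\<bar> \<le> B" for t
  proof -
    have wt: "w t > 0" by (rule emden_positive)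
    have "0 \<le> max 0 (w t) powr (p + 1) / (p + 1)" using p by simp
    then have "(w1 t)\<^sup>2 \<le> a * (1 - a) * (w t)\<^sup>2"
      using energy_neg[of t] unfolding energy_def by linarith
    also have "\<dots> \<le> 1 * (w t)\<^sup>2" using k by (intro mult_right_mono) auto
    finally have "\<bar>w1 t\<bar> \<le> w t" using wt by (simp add: abs_le_square_iff[symmetric])
    then show ?thesis using wB[of t] by simp
  qed
  then show ?thesis using that B wB by blast
qed

text \<open>Barbalat's lemma is applied twice: to the convergent energy, giving w1 -> 0, and to w1,
  giving w2 -> 0. The equation then yields w (k - w^(p-1)) -> 0, where w is bounded away from 0
  because the energy stays below its negative value at time 0.\<close>

lemma emden_tendsto_at_top: "(w \<longlongrightarrow> (a * (1 - a)) powr (1 / (p - 1))) at_top"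
proof -
  define k where "k = a * (1 - a)"
  have k: "k > 0" using a by (simp add: k_def)
  note wpos = emden_positive
  obtain B where B: "B > 0" "\<And>t. w t \<le> B" "\<And>t. \<bar>w1 t\<bar> \<le> B" using emden_bounded by blast
  define w2 where "w2 t = (1 - 2 * a) * w1 t + k * w t - w t powr p" for t
  have w1'': "(w1 has_real_derivative w2 t) (at t)" for t
    using w1'[of t] wpos[of t] by (simp add: w2_def k_def)
  define w3 where "w3 t = (1 - 2 * a) * w2 t + k * w1 t - p * w t powr (p - 1) * w1 t" for t
  have w2': "(w2 has_real_derivative w3 t) (at t)" for t
  proof -
    have wp: "((\<lambda>t. w t powr p) has_real_derivative p * w t powr (p - 1) * w1 t) (at t)"
      using DERIV_chain2[OF has_real_derivative_powr[OF wpos] w'] .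
    have "((\<lambda>t. (1 - 2 * a) * w1 t + k * w t - w t powr p) has_real_derivative w3 t) (at t)"
      unfolding w3_def by (intro DERIV_diff DERIV_add DERIV_cmult w' w1'' wp)
    then show ?thesis unfolding w2_def[abs_def] .
  qed
  \<comment> \<open>Bounds for the second and third derivatives of w, which provide the constant
    \<open>M\<close> in the two uses of Barbalat's lemma.\<close>
  define B2 where "B2 = \<bar>1 - 2 * a\<bar> * B + k * B + B powr p"
  define B3 where "B3 = \<bar>1 - 2 * a\<bar> * B2 + k * B + p * B powr (p - 1) * B"
  have abs3: "\<bar>x + y - z\<bar> \<le> \<bar>x\<bar> + \<bar>y\<bar> + \<bar>z\<bar>" for x y z :: real by linarith
  have w2B: "\<bar>w2 t\<bar> \<le> B2" for t
  proof -
    have "\<bar>w2 t\<bar> \<le> \<bar>1 - 2 * a\<bar> * \<bar>w1 t\<bar> + k * \<bar>w t\<bar> + w t powr p"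
      unfolding w2_def using abs3[of "(1 - 2 * a) * w1 t" "k * w t" "w t powr p"] k
      by (simp add: abs_mult)
    also have "\<dots> \<le> B2"
      unfolding B2_def using B(2,3)[of t] wpos[of t] k p
      by (intro add_mono mult_left_mono powr_mono2) auto
    finally show ?thesis .
  qed
  have B2: "B2 > 0" using B k by (simp add: B2_def add_nonneg_pos add_pos_pos)
  have w3B: "\<bar>w3 t\<bar> \<le> B3" for t
  proof -
    have "\<bar>w3 t\<bar> \<le> \<bar>1 - 2 * a\<bar> * \<bar>w2 t\<bar> + k * \<bar>w1 t\<bar> + p * w t powr (p - 1) * \<bar>w1 t\<bar>"
      unfolding w3_def
      using abs3[of "(1 - 2 * a) * w2 t" "k * w1 t" "p * w t powr (p - 1) * w1 t"] k p
      by (simp add: abs_mult)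
    also have "\<dots> \<le> B3"
      unfolding B3_def using B(2,3)[of t] wpos[of t] k p w2B[of t]
      by (intro add_mono mult_mono powr_mono2 order_refl) auto
    finally show ?thesis .
  qed
  have B3: "B3 > 0" using B B2 k p by (simp add: B3_def add_nonneg_pos add_pos_pos)
  \<comment> \<open>Reversing both time and sign turns the nonincreasing energy at plus infinity
    into a nonincreasing function at minus infinity, for which convergence is already
    available.\<close>
  define l where "l = Sup (range (\<lambda>t. - energy (- t)))"
  have "((\<lambda>t. - energy (- t)) \<longlongrightarrow> l) at_bot"
    unfolding l_def
  proof (rule antimono_bounded_tendsto_at_bot)
    show "- energy (- t) \<le> - energy (- s)" if "s \<le> t" for s t
      using energy_antimono[of "- t" "- s"] that by simp
    show "bdd_above (range (\<lambda>t. - energy (- t)))"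
    proof (rule bdd_aboveI2)
      fix t
      have "(w (- t))\<^sup>2 \<le> B\<^sup>2" using B(2)[of "- t"] wpos[of "- t"] by (intro power_mono) auto
      then have "k * (w (- t))\<^sup>2 / 2 \<le> k * B\<^sup>2 / 2" using k by simp
      moreover have "0 \<le> max 0 (w (- t)) powr (p + 1) / (p + 1)" using p by simp
      ultimately show "- energy (- t) \<le> k * B\<^sup>2 / 2"
        unfolding energy_def k_def using zero_le_power2[of "w1 (- t)"] by linarith
    qed
  qed
  then have "((\<lambda>t. - energy t) \<longlongrightarrow> l) at_top"
    by (subst filterlim_at_top_mirror)
  then have "(energy \<longlongrightarrow> - l) at_top" using tendsto_minus[of "\<lambda>t. - energy t"] by fastforce
  then have "((\<lambda>t. (1 - 2 * a) * (w1 t)\<^sup>2) \<longlongrightarrow> 0) at_top"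
  proof (rule barbalat[OF _ energy_deriv])
    show "((\<lambda>t. (1 - 2 * a) * (w1 t)\<^sup>2) has_real_derivative (1 - 2 * a) * (2 * w1 t * w2 t)) (at t)" for t
      by (auto intro!: derivative_eq_intros w1'')
    show "\<bar>(1 - 2 * a) * (2 * w1 t * w2 t)\<bar> \<le> \<bar>1 - 2 * a\<bar> * (2 * B * B2)" for t
      unfolding abs_mult using B w2B[of t] by (intro mult_left_mono mult_mono) auto
    show "0 < \<bar>1 - 2 * a\<bar> * (2 * B * B2)" using a B B2 by simp
  qed
  then have "((\<lambda>t. (1 - 2 * a) * (w1 t)\<^sup>2 / (1 - 2 * a)) \<longlongrightarrow> 0 / (1 - 2 * a)) at_top"
    using a by (intro tendsto_intros) auto
  then have "((\<lambda>t. (w1 t)\<^sup>2) \<longlongrightarrow> 0) at_top" using a by simp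
  then have "((\<lambda>t. sqrt ((w1 t)\<^sup>2)) \<longlongrightarrow> sqrt 0) at_top" by (rule tendsto_real_sqrt)
  then have w1lim: "(w1 \<longlongrightarrow> 0) at_top" by (simp add: tendsto_rabs_zero_iff)
  have w2lim: "(w2 \<longlongrightarrow> 0) at_top"
    by (rule barbalat[OF w1lim w1'' w2' w3B B3])
  have "((\<lambda>t. w2 t - (1 - 2 * a) * w1 t) \<longlongrightarrow> 0 - (1 - 2 * a) * 0) at_top"
    by (intro tendsto_intros w1lim w2lim)
  then have flim: "((\<lambda>t. k * w t - w t powr p) \<longlongrightarrow> 0) at_top" by (simp add: w2_def)
  \<comment> \<open>For t >= 0 the energy is at most energy 0 and at least - k w^2 / 2; solving for
    w gives this lower bound.\<close>
  define c where "c = sqrt (- 2 * energy 0 / k)"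
  have c: "c > 0" using energy_neg[of 0] k by (simp add: c_def divide_neg_pos)
  have wc: "c \<le> w t" if "t \<ge> 0" for t
  proof -
    have "0 \<le> max 0 (w t) powr (p + 1) / (p + 1)" using p by simp
    then have "- energy 0 \<le> k * (w t)\<^sup>2 / 2"
      using energy_antimono[OF that] zero_le_power2[of "w1 t"]
      unfolding energy_def[of t] k_def by linarith
    then have "- 2 * energy 0 / k \<le> (w t)\<^sup>2" using k by (simp add: field_simps)
    then show ?thesis unfolding c_def using wpos[of t] by (simp add: real_le_lsqrt)
  qed
  have "((\<lambda>t. k - w t powr (p - 1)) \<longlongrightarrow> 0) at_top"
  proof (rule tendsto_0_le[OF flim])
    show "\<forall>\<^sub>F t in at_top. norm (k - w t powr (p - 1)) \<le> norm (k * w t - w t powr p) * (1 / c)"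
      using eventually_ge_at_top[of 0]
    proof eventually_elim
      case (elim t)
      have "w t powr p = w t * w t powr (p - 1)" using wpos[of t] by (simp add: powr_mult_base)
      then have "norm (k * w t - w t powr p) = w t * norm (k - w t powr (p - 1))"
        using wpos[of t] by (simp add: abs_mult right_diff_distrib[symmetric] mult.commute[of k])
      moreover have "c * norm (k - w t powr (p - 1)) \<le> w t * norm (k - w t powr (p - 1))"
        using wc[OF elim] by (intro mult_right_mono) auto
      ultimately show ?case using c by (simp add: field_simps)
    qed
  qed
  then have "((\<lambda>t. k - (k - w t powr (p - 1))) \<longlongrightarrow> k - 0) at_top"
    by (intro tendsto_intros)
  then have "((\<lambda>t. w t powr (p - 1)) \<longlongrightarrow> k) at_top" by simp
  then have "((\<lambda>t. (w t powr (p - 1)) powr (1 / (p - 1))) \<longlongrightarrow> k powr (1 / (p - 1))) at_top"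
    using k by (intro tendsto_powr tendsto_const) auto
  then show ?thesis using wpos p by (simp add: powr_powr k_def less_imp_le)
qed

end

lemma emden_heteroclinic_exists:
  assumes a: "1/2 < a" "a < 1" and p: "p > 1"
  shows "\<exists>w w1. emden_sol a p w w1 \<and> (w \<longlongrightarrow> 0) at_bot \<and>
    (w \<longlongrightarrow> (a * (1 - a)) powr (1 / (p - 1))) at_top"
proof -
  have \<mu>: "(p - 1) * (1 - a) > 0" using a p by simp
  obtain z V where z': "\<And>t. (z has_real_derivative V t - z t) (at t)"
    and V': "\<And>t. (V has_real_derivative - exp ((p - 1) * (1 - a) * t) * clamped_powr p (z t)) (at t)"
    and z1: "\<And>t. z t \<le> 1" and zlim: "(z \<longlongrightarrow> 1) at_bot" and Vlim: "(V \<longlongrightarrow> 1) at_bot"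
    by (rule emden_system_exists[OF p \<mu>]) (rule that)
  define w where "w t = exp ((1 - a) * t) * z t" for t
  define w1 where "w1 t = exp ((1 - a) * t) * (V t - a * z t)" for t
  have V'': "(V has_real_derivative - exp ((p - 1) * (1 - a) * t) * max 0 (z t) powr p) (at t)" for t
    using V'[of t] clamped_powr_eq[OF z1] by simp
  have w': "(w has_real_derivative w1 t) (at t)"
    and w1': "(w1 has_real_derivative (1 - 2 * a) * w1 t + a * (1 - a) * w t - max 0 (w t) powr p) (at t)" for t
    unfolding w_def[abs_def] w1_def[abs_def] using emden_system_deriv[OF z' V''] by auto
  have "((\<lambda>t. exp ((1 - a) * t) * z t) \<longlongrightarrow> 0 * 1) at_bot"
    using a by (intro tendsto_intros zlim tendsto_exp_mult_at_bot) auto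
  then have wlim: "(w \<longlongrightarrow> 0) at_bot" by (simp add: w_def[abs_def])
  have "((\<lambda>t. exp ((1 - a) * t) * (V t - a * z t)) \<longlongrightarrow> 0 * (1 - a * 1)) at_bot"
    using a by (intro tendsto_intros zlim Vlim tendsto_exp_mult_at_bot) auto
  then have w1lim: "(w1 \<longlongrightarrow> 0) at_bot" by (simp add: w1_def[abs_def])
  have "\<forall>\<^sub>F t in at_bot. z t > 0" using order_tendstoD(1)[OF zlim] by simp
  then have pos: "\<forall>\<^sub>F t in at_bot. w t > 0" by (simp add: w_def zero_less_mult_iff)
  note facts = a p w' w1' wlim w1lim pos
  have "w t > 0" for t by (rule emden_positive[OF facts])
  then have "emden_sol a p w w1"
    unfolding emden_sol_def using w' w1' by (metis max.absorb2 less_imp_le)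
  then show ?thesis using wlim emden_tendsto_at_top[OF facts] by blast
qed

text \<open>Without damping there is a closed form: u(x) = C x (1 + x^n)^(-1/n) with n = (p - 1) /
  2, so w is a multiple of cosh (n t / 2)^(-1/n). Here \<open>e\<close> is 1 + x^n, \<open>z\<close>
  is u(x)/x and \<open>V\<close> is u'(x).\<close>

lemma emden_homoclinic_exists:
  assumes p: "p > 1"
  shows "\<exists>w w1. emden_sol (1/2) p w w1 \<and> (w \<longlongrightarrow> 0) at_bot \<and> (w \<longlongrightarrow> 0) at_top"
proof -
  define n where "n = (p - 1) / 2"
  have n: "n > 0" "p = 2 * n + 1" using p by (auto simp: n_def field_simps)
  \<comment> \<open>C^(p-1) = n + 1 makes the coefficient in V' = - exp (n t) z^p equal to
    one.\<close>
  define C where "C = (n + 1) powr (1 / (p - 1))"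
  have C: "C > 0" using n by (simp add: C_def)
  have Cp: "C powr p = C * (n + 1)"
  proof -
    have "C powr (p - 1) = n + 1" using n p by (simp add: C_def powr_powr)
    then show ?thesis using powr_mult_base[of C "p - 1"] C by simp
  qed
  define e where "e t = 1 + exp (n * t)" for t
  have e: "e t > 0" "e t \<ge> 1" "(e has_real_derivative n * (e t - 1)) (at t)" for t
    unfolding e_def[abs_def] by (auto intro!: derivative_eq_intros add_pos_pos)
  have epowr: "((\<lambda>t. e t powr r) has_real_derivative r * e t powr (r - 1) * (n * (e t - 1))) (at t)" for r t
    using DERIV_chain2[OF has_real_derivative_powr[OF e(1)] e(3)] .
  define z where "z t = C * e t powr (- 1 / n)" for t
  define V where "V t = C * e t powr (- 1 / n - 1)" for t
  have zpos: "z t > 0" for t using C e(1)[of t] by (simp add: z_def)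
  have ze: "z t = V t * e t" for t
  proof -
    have "e t powr (- 1 / n) = e t powr (- 1 / n - 1) * e t"
      using powr_mult_base[of "e t" "- 1 / n - 1"] e(1)[of t] by (simp add: mult.commute)
    then show ?thesis by (simp add: z_def V_def)
  qed
  have z': "(z has_real_derivative V t - z t) (at t)" for t
  proof -
    have "(z has_real_derivative C * (- 1 / n * e t powr (- 1 / n - 1) * (n * (e t - 1)))) (at t)"
      unfolding z_def[abs_def] by (intro DERIV_cmult epowr)
    also have "C * (- 1 / n * e t powr (- 1 / n - 1) * (n * (e t - 1))) = V t - V t * e t"
      using n by (simp add: V_def field_simps)
    finally show ?thesis by (simp only: ze[of t])
  qed
  have V': "(V has_real_derivative - exp ((p - 1) * (1 - 1/2) * t) * max 0 (z t) powr p) (at t)" for t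
  proof -
    have "(V has_real_derivative C * ((- 1 / n - 1) * e t powr (- 1 / n - 1 - 1) * (n * (e t - 1)))) (at t)"
      unfolding V_def[abs_def] by (intro DERIV_cmult epowr)
    also have "C * ((- 1 / n - 1) * e t powr (- 1 / n - 1 - 1) * (n * (e t - 1))) =
        - (e t - 1) * (C * (n + 1) * e t powr (- 1 / n - 1 - 1))"
      using n by (simp add: field_simps)
    also have "C * (n + 1) * e t powr (- 1 / n - 1 - 1) = z t powr p"
    proof -
      have "- 1 / n * p = - 1 / n - 1 - 1" using n by (simp add: field_simps)
      then show ?thesis using C e(1)[of t] by (simp add: z_def powr_mult powr_powr Cp)
    qed
    also have "e t - 1 = exp ((p - 1) * (1 - 1/2) * t)" using n by (simp add: e_def)
    finally show ?thesis using zpos[of t] by simp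
  qed
  define w where "w t = exp ((1 - 1/2) * t) * z t" for t
  define w1 where "w1 t = exp ((1 - 1/2) * t) * (V t - 1/2 * z t)" for t
  have wpos: "w t > 0" for t using zpos by (simp add: w_def)
  have "emden_sol (1/2) p w w1"
    unfolding emden_sol_def
  proof (intro allI conjI)
    fix t
    show "w t > 0" by (rule wpos)
    show "(w has_real_derivative w1 t) (at t)"
      using emden_system_deriv(1)[OF z' V'] unfolding w_def[abs_def] w1_def[abs_def] .
    have "(w1 has_real_derivative (1 - 2 * (1/2)) * w1 t + 1/2 * (1 - 1/2) * w t - max 0 (w t) powr p) (at t)"
      using emden_system_deriv(2)[OF z' V'] unfolding w_def[abs_def] w1_def[abs_def] .
    then show "(w1 has_real_derivative (1 - 2 * (1/2)) * w1 t + 1/2 * (1 - 1/2) * w t - w t powr p) (at t)"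
      using max.absorb2[OF less_imp_le[OF wpos[of t]]] by (simp only:)
  qed
  moreover have "(w \<longlongrightarrow> 0) at_bot"
  proof (rule tendsto_0_le[OF tendsto_exp_mult_at_bot[of "1/2"]])
    show "\<forall>\<^sub>F t in at_bot. norm (w t) \<le> norm (exp (1/2 * t)) * C"
    proof (intro always_eventually allI)
      fix t
      have "e t powr (- 1 / n) \<le> e t powr 0" using n e(2)[of t] by (intro powr_mono) auto
      then have "z t \<le> C" using C e(1)[of t] by (simp add: z_def)
      then show "norm (w t) \<le> norm (exp (1/2 * t)) * C" using zpos[of t] by (simp add: w_def abs_mult)
    qed
  qed simp
  moreover have "(w \<longlongrightarrow> 0) at_top"
  proof (rule tendsto_0_le)
    show "((\<lambda>t. exp (1/2 * - t)) \<longlongrightarrow> (0::real)) at_top"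
      by (rule filterlim_compose[OF tendsto_exp_mult_at_bot filterlim_uminus_at_bot_at_top]) simp
    show "\<forall>\<^sub>F t in at_top. norm (w t) \<le> norm (exp (1/2 * - t)) * C"
    proof (intro always_eventually allI)
      fix t
      \<comment> \<open>Keeping only the summand exp (n t) of \<open>e\<close> gives z <= C exp (-
        t), hence w <= C exp (- t / 2).\<close>
      have "e t powr (- 1 / n) \<le> exp (n * t) powr (- 1 / n)"
        using n by (intro powr_mono2') (auto simp: e_def)
      also have "\<dots> = exp (- t)" using n by (simp add: powr_def)
      finally have "z t \<le> C * exp (- t)" using C by (simp add: z_def)
      then have "w t \<le> exp ((1 - 1/2) * t) * (C * exp (- t))" unfolding w_def by simp
      also have "\<dots> = exp (1/2 * - t) * C" by (simp flip: exp_add)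
      finally show "norm (w t) \<le> norm (exp (1/2 * - t)) * C" using wpos[of t] by simp
    qed
  qed
  ultimately show ?thesis by blast
qed

section \<open>Transfer to the original equation\<close>

text \<open>Time reversal changes the sign of the damping coefficient 2 a - 1 and preserves a (1 -
  a), exactly as a -> 1 - a does.\<close>

lemma emden_sol_reflect:
  assumes "emden_sol a p w w1"
  shows "emden_sol (1 - a) p (\<lambda>t. w (- t)) (\<lambda>t. - w1 (- t))"
  unfolding emden_sol_def
proof (intro allI conjI)
  note D = emden_solD[OF assms]
  fix t
  show "w (- t) > 0" by (rule D)
  show "((\<lambda>t. w (- t)) has_real_derivative - w1 (- t)) (at t)"
    using D(2)[of "- t"] by (simp add: DERIV_mirror)
  have "((\<lambda>t. w1 (- t)) has_real_derivative
      - ((1 - 2 * a) * w1 (- t) + a * (1 - a) * w (- t) - w (- t) powr p)) (at t)"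
    using D(3)[of "- t"] by (simp only: DERIV_mirror)
  from DERIV_minus[OF this]
  show "((\<lambda>t. - w1 (- t)) has_real_derivative
      (1 - 2 * (1 - a)) * - w1 (- t) + (1 - a) * (1 - (1 - a)) * w (- t) - w (- t) powr p) (at t)"
    by (simp add: algebra_simps)
qed

lemma pos_sol_imp_emden_sol:
  assumes "pos_sol \<sigma> p u" and a: "a * (1 - p) = \<sigma> + 2"
  shows "\<exists>w1. emden_sol a p (\<lambda>t. exp (- a * t) * u (exp t)) w1"
proof -
  obtain u' u'' where u: "\<And>x. x > 0 \<Longrightarrow> u x > 0"
    and u': "\<And>x. x > 0 \<Longrightarrow> (u has_real_derivative u' x) (at x)"
    and u'': "\<And>x. x > 0 \<Longrightarrow> (u' has_real_derivative u'' x) (at x)"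
    and eq: "\<And>x. x > 0 \<Longrightarrow> u'' x + x powr \<sigma> * u x powr p = 0"
    using assms(1) unfolding pos_sol_def by blast
  have U: "((\<lambda>t. u (exp t)) has_real_derivative u' (exp t) * exp t) (at t)"
    and U': "((\<lambda>t. u' (exp t)) has_real_derivative u'' (exp t) * exp t) (at t)" for t
    by (rule DERIV_chain2[OF u' DERIV_exp] DERIV_chain2[OF u'' DERIV_exp]; simp)+
  define w where "w t = exp (- a * t) * u (exp t)" for t
  define w1 where "w1 t = exp (- a * t) * (exp t * u' (exp t) - a * u (exp t))" for t
  have "emden_sol a p w w1"
    unfolding emden_sol_def
  proof (intro allI conjI)
    fix t
    show wt: "w t > 0" using u by (simp add: w_def)
    show "(w has_real_derivative w1 t) (at t)"
      unfolding w_def[abs_def] w1_def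
      by (auto intro!: derivative_eq_intros U simp: algebra_simps)
    have "w t powr p = exp (- a * t * p) * u (exp t) powr p"
      using u[of "exp t"] by (simp add: w_def powr_mult powr_def[of "exp _"] mult_ac)
    \<comment> \<open>The choice of a enters here: - a p = 2 - a + \<sigma>, so w^p carries the same
      factor exp ((2 - a) t) as u'' and the equation becomes autonomous.\<close>
    also have "- a * t * p = - a * t + t + t + \<sigma> * t"
      using a by algebra
    also have "exp \<dots> = exp (- a * t) * exp t * exp t * exp (\<sigma> * t)" by (simp only: exp_add)
    also have "exp (\<sigma> * t) = exp t powr \<sigma>" by (simp add: powr_def)
    finally have "w t powr p = exp (- a * t) * exp t * exp t * (exp t powr \<sigma> * u (exp t) powr p)"
      by (simp only: mult.assoc)
    moreover have "exp t powr \<sigma> * u (exp t) powr p = - u'' (exp t)"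
      using eq[of "exp t"] by (simp add: add_eq_0_iff)
    ultimately have wp: "w t powr p = - (exp (- a * t) * exp t * exp t * u'' (exp t))" by simp
    show "(w1 has_real_derivative (1 - 2 * a) * w1 t + a * (1 - a) * w t - w t powr p) (at t)"
      unfolding wp unfolding w1_def[abs_def] w_def
      by (auto intro!: derivative_eq_intros U U' simp: algebra_simps)
  qed
  then show ?thesis unfolding w_def[abs_def] by blast
qed

lemma emden_sol_imp_pos_sol:
  assumes w: "emden_sol a p w w1" and a: "a * (1 - p) = \<sigma> + 2"
  shows "pos_sol \<sigma> p (\<lambda>x. x powr a * w (ln x))"
proof -
  note D = emden_solD[OF w]
  define u where "u x = x powr a * w (ln x)" for x
  define u' where "u' x = x powr (a - 1) * (a * w (ln x) + w1 (ln x))" for x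
  \<comment> \<open>Taking u'' from the equation makes the equation immediate and derives continuity
    of u'' from that of u; what remains is that it is the derivative of u'.\<close>
  define u'' where "u'' x = - (x powr \<sigma> * u x powr p)" for x
  have L: "(ln has_real_derivative 1 / x) (at x)" if "x > 0" for x
    using that by (auto intro!: derivative_eq_intros)
  have W: "((\<lambda>x. w (ln x)) has_real_derivative w1 (ln x) * (1 / x)) (at x)"
    and W1: "((\<lambda>x. w1 (ln x)) has_real_derivative
        ((1 - 2 * a) * w1 (ln x) + a * (1 - a) * w (ln x) - w (ln x) powr p) * (1 / x)) (at x)"
    if "x > 0" for x
    using DERIV_chain2[OF D(2) L[OF that]] DERIV_chain2[OF D(3) L[OF that]] by auto
  have P: "((\<lambda>x. x powr r) has_real_derivative r * (x powr r * (1 / x))) (at x)"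
    if "x > 0" for r x :: real
    using has_real_derivative_powr[OF that, of r] that by (simp add: powr_diff)
  have du: "(u has_real_derivative u' x) (at x)" if "x > 0" for x
  proof -
    have "(u has_real_derivative a * (x powr a * (1 / x)) * w (ln x)
        + w1 (ln x) * (1 / x) * x powr a) (at x)"
      unfolding u_def[abs_def] by (rule DERIV_mult[OF P W]; rule that)
    moreover have "x powr (a - 1) = x powr a * (1 / x)" using that by (simp add: powr_diff)
    ultimately show ?thesis by (simp add: u'_def algebra_simps)
  qed
  have du': "(u' has_real_derivative u'' x) (at x)" if "x > 0" for x
  proof -
    let ?d = "a * (w1 (ln x) * (1 / x))
        + ((1 - 2 * a) * w1 (ln x) + a * (1 - a) * w (ln x) - w (ln x) powr p) * (1 / x)"
    have "(u' has_real_derivative (a - 1) * (x powr (a - 1) * (1 / x)) * (a * w (ln x) + w1 (ln x))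
        + ?d * x powr (a - 1)) (at x)"
      unfolding u'_def[abs_def] by (intro DERIV_mult[OF P] DERIV_add DERIV_cmult W W1 that)
    \<comment> \<open>All terms linear in w and w1 cancel. The remaining power is a - 2 = \<sigma> +
      a p, which splits into x^\<sigma> and (x^a)^p.\<close>
    also have "(a - 1) * (x powr (a - 1) * (1 / x)) * (a * w (ln x) + w1 (ln x))
        + ?d * x powr (a - 1) = - (x powr (a - 1) * (1 / x) * w (ln x) powr p)"
      by algebra
    also have "x powr (a - 1) * (1 / x) = x powr (\<sigma> + a * p)"
    proof -
      have "\<sigma> + a * p = a - 1 - 1" using a by (simp add: algebra_simps)
      then show ?thesis using that by (simp add: powr_diff power2_eq_square)
    qed
    also have "- (x powr (\<sigma> + a * p) * w (ln x) powr p) = u'' x"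
      using D(1)[of "ln x"] that by (simp add: u''_def u_def powr_mult powr_powr powr_add)
    finally show ?thesis .
  qed
  have "continuous_on {0<..} u"
    by (intro continuous_at_imp_continuous_on ballI DERIV_isCont[OF du]) simp
  moreover have upos: "u x > 0" if "x > 0" for x using D(1) that by (simp add: u_def)
  ultimately have "continuous_on {0<..} u''"
    unfolding u''_def[abs_def] by (intro continuous_intros) (auto simp: less_imp_neq[symmetric])
  then have "pos_sol \<sigma> p u"
    unfolding pos_sol_def using du du' upos
    by (intro exI[of _ u'] exI[of _ u'']) (auto simp: u''_def)
  then show ?thesis by (simp add: u_def[abs_def])
qed

context
  fixes \<sigma> p a :: real
  assumes a: "a = exp_a \<sigma> p" "0 < a" "a < 1" and p: "p > 1"
begin

lemma exp_a_eq: "a * (1 - p) = \<sigma> + 2"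
  using p by (simp add: a(1) exp_a_def)

lemma const_a_pos: "const_a \<sigma> p > 0"
  using a(2,3) by (simp add: const_a_def flip: a(1))

lemma asym_sol_imp_emden_sol:
  assumes "asym_sol \<sigma> p L0 Linf u"
  obtains w1 where "emden_sol a p (\<lambda>t. exp (- a * t) * u (exp t)) w1"
    "((\<lambda>t. exp (- a * t) * u (exp t)) \<longlongrightarrow> L0 * const_a \<sigma> p) at_bot"
    "((\<lambda>t. exp (- a * t) * u (exp t)) \<longlongrightarrow> Linf * const_a \<sigma> p) at_top"
proof -
  have "pos_sol \<sigma> p u" and lim: "((\<lambda>x. u x / u_a \<sigma> p x) \<longlongrightarrow> L0) (at_right 0)"
      "((\<lambda>x. u x / u_a \<sigma> p x) \<longlongrightarrow> Linf) at_top"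
    using assms by (auto simp: asym_sol_def)
  \<comment> \<open>The quotient by \<open>u_a\<close> at x = exp t is w t divided by
    \<open>const_a\<close>, so limits of the quotient and of w correspond.\<close>
  have eq: "u (exp t) / u_a \<sigma> p (exp t) * const_a \<sigma> p = exp (- a * t) * u (exp t)" for t
    using const_a_pos by (simp add: u_a_def powr_def exp_minus field_simps flip: a(1))
  have bot: "filterlim exp (at_right (0::real)) at_bot"
    using filterlim_exp_mult_at_right_0[of 1] by simp
  obtain w1 where "emden_sol a p (\<lambda>t. exp (- a * t) * u (exp t)) w1"
    using pos_sol_imp_emden_sol[OF \<open>pos_sol \<sigma> p u\<close> exp_a_eq] by blast
  moreover have "((\<lambda>t. exp (- a * t) * u (exp t)) \<longlongrightarrow> L0 * const_a \<sigma> p) at_bot"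
    using tendsto_mult_right[OF filterlim_compose[OF lim(1) bot], of "const_a \<sigma> p"] by (simp only: eq)
  moreover have "((\<lambda>t. exp (- a * t) * u (exp t)) \<longlongrightarrow> Linf * const_a \<sigma> p) at_top"
    using tendsto_mult_right[OF filterlim_compose[OF lim(2) exp_at_top], of "const_a \<sigma> p"]
    by (simp only: eq)
  ultimately show ?thesis by (rule that)
qed

lemma emden_sol_imp_asym_sol:
  assumes w: "emden_sol a p w w1" and lim: "(w \<longlongrightarrow> L0 * const_a \<sigma> p) at_bot"
    "(w \<longlongrightarrow> Linf * const_a \<sigma> p) at_top"
  shows "asym_sol \<sigma> p L0 Linf (\<lambda>x. x powr a * w (ln x))"
proof -
  have eq: "x powr a * w (ln x) / u_a \<sigma> p x = w (ln x) / const_a \<sigma> p" if "x > 0" for x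
    using const_a_pos that by (simp add: u_a_def flip: a(1))
  have "((\<lambda>x. w (ln x) / const_a \<sigma> p) \<longlongrightarrow> L0 * const_a \<sigma> p / const_a \<sigma> p) (at_right 0)"
    using const_a_pos by (intro tendsto_divide filterlim_compose[OF lim(1) ln_at_0] tendsto_const) auto
  then have "((\<lambda>x. x powr a * w (ln x) / u_a \<sigma> p x) \<longlongrightarrow> L0 * const_a \<sigma> p / const_a \<sigma> p) (at_right 0)"
    by (rule Lim_transform_eventually) (auto simp: eventually_at_filter eq)
  moreover have "((\<lambda>x. w (ln x) / const_a \<sigma> p) \<longlongrightarrow> Linf * const_a \<sigma> p / const_a \<sigma> p) at_top"
    using const_a_pos by (intro tendsto_divide filterlim_compose[OF lim(2) ln_at_top] tendsto_const) auto
  then have "((\<lambda>x. x powr a * w (ln x) / u_a \<sigma> p x) \<longlongrightarrow> Linf * const_a \<sigma> p / const_a \<sigma> p) at_top"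
    by (rule Lim_transform_eventually)
       (rule eventually_mono[OF eventually_gt_at_top[of 0]], simp add: eq)
  ultimately show ?thesis
    using emden_sol_imp_pos_sol[OF w exp_a_eq] const_a_pos by (simp add: asym_sol_def)
qed

text \<open>Translation of w by \<tau> is scaling of u with l = exp \<tau>: the powers of l cancel
  in l^(-a) (l x)^a w (ln (l x)) = x^a w (ln x + \<tau>).\<close>

lemma exists_unique_scalingI:
  assumes w: "emden_sol a p w w1" "(w \<longlongrightarrow> L0 * const_a \<sigma> p) at_bot"
      "(w \<longlongrightarrow> Linf * const_a \<sigma> p) at_top"
    and unique: "\<And>v v1. emden_sol a p v v1 \<Longrightarrow> (v \<longlongrightarrow> L0 * const_a \<sigma> p) at_bot \<Longrightarrow>
      (v \<longlongrightarrow> Linf * const_a \<sigma> p) at_top \<Longrightarrow> \<exists>\<tau>. \<forall>t. v t = w (t + \<tau>)"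
  shows "exists_unique_scaling \<sigma> p L0 Linf"
  unfolding exists_unique_scaling_def
proof (intro exI[of _ "\<lambda>x. x powr a * w (ln x)"] conjI allI impI)
  show "asym_sol \<sigma> p L0 Linf (\<lambda>x. x powr a * w (ln x))"
    by (rule emden_sol_imp_asym_sol[OF w])
  fix v assume "asym_sol \<sigma> p L0 Linf v"
  then obtain \<tau> where \<tau>: "\<And>t. exp (- a * t) * v (exp t) = w (t + \<tau>)"
    using asym_sol_imp_emden_sol unique by (smt (verit, best))
  have "v x = exp \<tau> powr - exp_a \<sigma> p * ((exp \<tau> * x) powr a * w (ln (exp \<tau> * x)))" if "x > 0" for x
  proof -
    have "w (ln (exp \<tau> * x)) = x powr (- a) * v x"
      using \<tau>[of "ln x"] that by (simp add: ln_mult add.commute powr_def)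
    then show ?thesis using that by (simp add: powr_mult powr_minus field_simps flip: a(1))
  qed
  then show "\<exists>l>0. \<forall>x>0. v x = l powr - exp_a \<sigma> p * ((l * x) powr a * w (ln (l * x)))"
    by (intro exI[of _ "exp \<tau>"]) auto
qed

end

theorem theorem5p2:
  fixes \<sigma> p :: real
  assumes "\<sigma> < -2" and "p > -1 - \<sigma>"
  shows "(exp_a \<sigma> p > 1/2 \<longrightarrow> exists_unique_scaling \<sigma> p 0 1) \<and>
         (exp_a \<sigma> p = 1/2 \<longrightarrow> exists_unique_scaling \<sigma> p 0 0) \<and>
         (exp_a \<sigma> p < 1/2 \<longrightarrow> exists_unique_scaling \<sigma> p 1 0)"
proof -
  define a where "a = exp_a \<sigma> p"
  have p: "p > 1" using assms by linarith
  \<comment> \<open>Now numerator and denominator are positive: \<sigma> < -2 gives a > 0, and p >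
    -1 - \<sigma> gives a < 1.\<close>
  have "a = (- \<sigma> - 2) / (p - 1)" using p by (simp add: a_def exp_a_def field_simps)
  then have a: "a = exp_a \<sigma> p" "0 < a" "a < 1" using assms p by (auto simp: a_def)
  have c: "const_a \<sigma> p = (a * (1 - a)) powr (1 / (p - 1))" by (simp add: const_a_def a_def)
  note I = exists_unique_scalingI[OF a p] and U = emden_sol_unique[OF _ _ p]
  have "exists_unique_scaling \<sigma> p 0 1" if gt: "a > 1/2"
  proof -
    obtain w w1 where "emden_sol a p w w1" "(w \<longlongrightarrow> 0) at_bot" "(w \<longlongrightarrow> const_a \<sigma> p) at_top"
      using emden_heteroclinic_exists[OF gt a(3) p] unfolding c by blast
    then show ?thesis using U[OF a(2,3)] by (intro I) auto
  qed
  moreover have "exists_unique_scaling \<sigma> p 0 0" if half: "a = 1/2"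
  proof -
    obtain w w1 where "emden_sol a p w w1" "(w \<longlongrightarrow> 0) at_bot" "(w \<longlongrightarrow> 0) at_top"
      using emden_homoclinic_exists[OF p] unfolding half by blast
    then show ?thesis using U[OF a(2,3)] by (intro I) auto
  qed
  moreover have "exists_unique_scaling \<sigma> p 1 0" if lt: "a < 1/2"
  proof -
    \<comment> \<open>The heteroclinic orbit for 1 - a > 1/2, to be run backwards. Its limit is the
      constant belonging to a, since a (1 - a) is symmetric.\<close>
    obtain w w1 where w: "emden_sol (1 - a) p w w1" "(w \<longlongrightarrow> 0) at_bot" "(w \<longlongrightarrow> const_a \<sigma> p) at_top"
      using emden_heteroclinic_exists[of "1 - a" p] a lt p unfolding c by (auto simp: mult.commute)
    show ?thesis
    proof (rule I)
      show "emden_sol a p (\<lambda>t. w (- t)) (\<lambda>t. - w1 (- t))"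
        using emden_sol_reflect[OF w(1)] by simp
      show "((\<lambda>t. w (- t)) \<longlongrightarrow> 1 * const_a \<sigma> p) at_bot"
        using filterlim_compose[OF w(3) filterlim_uminus_at_top_at_bot] by simp
      show "((\<lambda>t. w (- t)) \<longlongrightarrow> 0 * const_a \<sigma> p) at_top"
        using filterlim_compose[OF w(2) filterlim_uminus_at_bot_at_top] by simp
      fix v v1
      assume v: "emden_sol a p v v1" "(v \<longlongrightarrow> 0 * const_a \<sigma> p) at_top"
      \<comment> \<open>Reflection turns decay at plus infinity into decay at minus infinity, so
        uniqueness for the exponent 1 - a applies.\<close>
      have "((\<lambda>t. v (- t)) \<longlongrightarrow> 0) at_bot"
        using filterlim_compose[OF v(2) filterlim_uminus_at_top_at_bot] by simp
      then obtain \<tau> where \<tau>: "\<And>t. v (- t) = w (t + \<tau>)"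
        using U[OF _ _ w(1,2) emden_sol_reflect[OF v(1)]] a by auto
      have "v t = w (- (t + - \<tau>))" for t using \<tau>[of "- t"] by simp
      then show "\<exists>\<tau>. \<forall>t. v t = w (- (t + \<tau>))" by blast
    qed
  qed
  ultimately show ?thesis unfolding a_def by blast
qed

end
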